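(* Let $M$ be a compact connected oriented Riemannian manifold, $F\to M$ a $C^\infty$ Hermitian vector bundle, and $\nabla$ a flat Hermitian connection on $F$. Let $\nabla_t=\nabla+{\mathcal E}(t)$, $t\ge0$, be a curve of Hermitian connections with $E(t)\in{\mathscr A}^1({\mathfrak u}(F))$, $E(0)=0$, $E(t)=tE_1+t^2E_2+O(t^3)$, where $E_1:=\lim_{t\to0}E(t)/t$ and $E_2:=\lim_{t\to0}(E(t)-tE_1)/t^2$, and set $C_E:=\nabla E_2+E_1\wedge E_1$. If $\nabla_t$ is a curve of integrable (flat) connections, then $C_E=0$.
   Context: ${\mathscr F}$ is the sheaf of sections of $F$, ${\mathscr A}$ the sheaf of differentiable functions on $M$, ${\mathscr R}$ the sheaf of real-valued $C^\infty$ functions, ${\mathscr A}^k$ the sheaf of differential $k$-forms (real-valued when tensored over ${\mathscr R}$), ${\mathfrak u}({\mathscr F})$ the sheaf of antihermitian endomorphisms of $F$, and ${\mathscr A}^k({\mathfrak u}(F)):=\Gamma(M,{\mathscr A}^k\otimes_{\mathscr R}{\mathfrak u}({\mathscr F}))$. If locally $E=\sum_a\eta_a\otimes e_a$, the associated morphism ${\mathcal E}:{\mathscr F}\to{\mathscr A}^1\otimes_{\mathscr A}{\mathscr F}$ is ${\mathcal E}(\sigma)=\sum_a\eta_a\otimes e_a(\sigma)$, and $E\wedge E:=\sum_{a,b}(\eta_a\wedge\eta_b)\otimes(e_a\circ e_b)$. A connection is Hermitian if $\langle\nabla\sigma,\tau\rangle+\langle\sigma,\nabla\tau\rangle=d\langle\sigma,\tau\rangle$.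 It induces $\nabla:{\mathscr A}^k({\mathfrak u}(F))\to{\mathscr A}^{k+1}({\mathfrak u}(F))$, $\nabla(\beta\otimes h)=d\beta\otimes h+(-1)^k\beta\wedge(\nabla\circ h-h\circ\nabla)$. The curvature of $\nabla$ is $\nabla^1\circ\nabla$ with $\nabla^1(\beta\otimes\sigma)=d\beta\otimes\sigma-\beta\wedge\nabla\sigma$; $\nabla$ is integrable (flat) if its curvature vanishes. *)

theory Defs
  imports "HOL-Analysis.Analysis"
begin

section \<open>Smooth maps between Euclidean spaces\<close>

primrec ideriv ::
  "'a list \<Rightarrow> ('a::real_normed_vector \<Rightarrow> 'b::real_normed_vector) \<Rightarrow> 'a \<Rightarrow> 'b"
where
  "ideriv [] f = f"
| "ideriv (v # vs) f = (\<lambda>y. frechet_derivative (ideriv vs f) (at y) v)"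

text \<open>Only meant for open \<^term>\<open>S\<close>: all iterated directional derivatives are differentiable, hence
  continuous, on \<^term>\<open>S\<close>.\<close>

definition smooth_on ::
  "'a set \<Rightarrow> ('a::real_normed_vector \<Rightarrow> 'b::real_normed_vector) \<Rightarrow> bool"
where
  "smooth_on S f \<longleftrightarrow> (\<forall>vs. \<forall>y\<in>S. ideriv vs f differentiable (at y))"


section \<open>Oriented Riemannian manifolds\<close>

text \<open>The manifold is a whole type \<^typ>\<open>'m\<close>; a chart is its domain together with the coordinate map,
  whose values outside the domain are irrelevant.\<close>

type_synonym ('m, 'n) chart = "'m set \<times> ('m \<Rightarrow> real ^ 'n)"

definition in_chart :: "('m, 'n) chart \<Rightarrow> ('m \<Rightarrow> 'b) \<Rightarrow> real ^ 'n \<Rightarrow> 'b" where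
  "in_chart c f = (\<lambda>y. f (inv_into (fst c) (snd c) y))"

definition smooth_atlas ::
  "('m::{t2_space, second_countable_topology}, 'n::finite) chart set \<Rightarrow> bool"
where
  "smooth_atlas A \<longleftrightarrow>
     (\<Union>c\<in>A. fst c) = UNIV \<and>
     (\<forall>c\<in>A. open (fst c) \<and> open (snd c ` fst c) \<and>
        homeomorphism (fst c) (snd c ` fst c) (snd c) (inv_into (fst c) (snd c))) \<and>
     (\<forall>c\<in>A. \<forall>c'\<in>A. smooth_on (snd c ` (fst c \<inter> fst c')) (in_chart c (snd c')))"

definition jac :: "('m, 'n::finite) chart \<Rightarrow> ('m, 'n) chart \<Rightarrow> 'm \<Rightarrow> real ^ 'n \<Rightarrow> real ^ 'n" where
  "jac c c' x = frechet_derivative (in_chart c (snd c')) (at (snd c x))"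

definition oriented_atlas :: "('m, 'n::finite) chart set \<Rightarrow> bool" where
  "oriented_atlas A \<longleftrightarrow>
     (\<forall>c\<in>A. \<forall>c'\<in>A. \<forall>x\<in>fst c \<inter> fst c'. det (matrix (jac c c' x)) > 0)"

definition smooth_fun ::
  "('m, 'n::finite) chart set \<Rightarrow> 'm set \<Rightarrow> ('m \<Rightarrow> 'b::real_normed_vector) \<Rightarrow> bool"
where
  "smooth_fun A W f \<longleftrightarrow> (\<forall>c\<in>A. smooth_on (snd c ` (W \<inter> fst c)) (in_chart c f))"

text \<open>Covariant tensors are families of coordinate representations: the argument of type
  \<^typ>\<open>real ^ 'n\<close> following a chart \<^term>\<open>c\<close> and a point \<^term>\<open>x\<close> of its domain is the tangent vector
  at \<^term>\<open>x\<close> with these components in \<^term>\<open>c\<close>, and \<^const>\<open>jac\<close> changes the chart.\<close>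

definition riemannian_metric ::
  "('m, 'n::finite) chart set \<Rightarrow>
   (('m, 'n) chart \<Rightarrow> 'm \<Rightarrow> real ^ 'n \<Rightarrow> real ^ 'n \<Rightarrow> real) \<Rightarrow> bool"
where
  "riemannian_metric A g \<longleftrightarrow>
     (\<forall>c\<in>A. \<forall>x\<in>fst c. bilinear (g c x) \<and>
        (\<forall>u v. g c x u v = g c x v u) \<and> (\<forall>u. u \<noteq> 0 \<longrightarrow> g c x u u > 0)) \<and>
     (\<forall>c\<in>A. \<forall>c'\<in>A. \<forall>x\<in>fst c \<inter> fst c'. \<forall>u v. g c x u v = g c' x (jac c c' x u) (jac c c' x v)) \<and>
     (\<forall>c\<in>A. \<forall>u v. smooth_on (snd c ` fst c) (in_chart c (\<lambda>x. g c x u v)))"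

definition oriented_riemannian_manifold ::
  "('m::{t2_space, second_countable_topology}, 'n::finite) chart set \<Rightarrow>
   (('m, 'n) chart \<Rightarrow> 'm \<Rightarrow> real ^ 'n \<Rightarrow> real ^ 'n \<Rightarrow> real) \<Rightarrow> bool"
where
  "oriented_riemannian_manifold A g \<longleftrightarrow>
     smooth_atlas A \<and> oriented_atlas A \<and> riemannian_metric A g"


section \<open>Scalar differential forms\<close>

text \<open>One-forms are complex valued; they form a module over the complex valued smooth functions.\<close>

type_synonym ('m, 'n, 'b) form1 = "('m, 'n) chart \<Rightarrow> 'm \<Rightarrow> real ^ 'n \<Rightarrow> 'b"

definition one_form ::
  "('m, 'n::finite) chart set \<Rightarrow> 'm set \<Rightarrow> ('m, 'n, complex) form1 \<Rightarrow> bool"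
where
  "one_form A W \<beta> \<longleftrightarrow>
     (\<forall>c\<in>A. \<forall>x\<in>W \<inter> fst c. linear (\<beta> c x)) \<and>
     (\<forall>c\<in>A. \<forall>c'\<in>A. \<forall>x\<in>W \<inter> fst c \<inter> fst c'. \<forall>u. \<beta> c x u = \<beta> c' x (jac c c' x u)) \<and>
     (\<forall>c\<in>A. \<forall>u. smooth_on (snd c ` (W \<inter> fst c)) (in_chart c (\<lambda>x. \<beta> c x u)))"

definition real_one_form ::
  "('m, 'n::finite) chart set \<Rightarrow> 'm set \<Rightarrow> ('m, 'n, complex) form1 \<Rightarrow> bool"
where
  "real_one_form A W \<beta> \<longleftrightarrow>
     one_form A W \<beta> \<and> (\<forall>c\<in>A. \<forall>x\<in>W \<inter> fst c. \<forall>u. \<beta> c x u \<in> \<real>)"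

definition d0 :: "('m \<Rightarrow> complex) \<Rightarrow> ('m, 'n::finite, complex) form1" where
  "d0 f c x u = frechet_derivative (in_chart c f) (at (snd c x)) u"

text \<open>For constant coordinate fields \<^term>\<open>u\<close> and \<^term>\<open>v\<close> the bracket term of the invariant formula
  for the exterior derivative vanishes.\<close>

definition d1 ::
  "('m, 'n::finite, complex) form1 \<Rightarrow>
   ('m, 'n) chart \<Rightarrow> 'm \<Rightarrow> real ^ 'n \<Rightarrow> real ^ 'n \<Rightarrow> complex"
where
  "d1 \<beta> c x u v = d0 (\<lambda>z. \<beta> c z v) c x u - d0 (\<lambda>z. \<beta> c z u) c x v"


section \<open>Hermitian vector bundles\<close>

text \<open>The fibres are subspaces of one complex vector space \<^typ>\<open>'v\<close>. This is no restriction, as any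
  family of vector spaces embeds into its direct sum: \<^typ>\<open>'v\<close> carries no topology, and different
  fibres are never compared in it. A local trivialization is given as the corresponding local frame,
  indexed by the numbers below the rank.\<close>

record ('m, 'v) vbundle =
  scl :: "complex \<Rightarrow> 'v \<Rightarrow> 'v"
  fibre :: "'m \<Rightarrow> 'v set"
  brank :: nat
  frames :: "('m set \<times> (nat \<Rightarrow> 'm \<Rightarrow> 'v)) set"
  herm :: "'m \<Rightarrow> 'v \<Rightarrow> 'v \<Rightarrow> complex"

text \<open>Smooth sections over \<^term>\<open>W\<close>. Here and below only the values on \<^term>\<open>W\<close> matter.\<close>

definition bsection ::
  "('m, 'n::finite) chart set \<Rightarrow> ('m, 'v::ab_group_add) vbundle \<Rightarrow> 'm set \<Rightarrow> ('m \<Rightarrow> 'v) \<Rightarrow> bool"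
where
  "bsection A B W \<sigma> \<longleftrightarrow>
     (\<forall>x\<in>W. \<sigma> x \<in> fibre B x) \<and>
     (\<forall>(U, e)\<in>frames B. \<exists>f. (\<forall>a<brank B. smooth_fun A (W \<inter> U) (f a)) \<and>
        (\<forall>x\<in>W \<inter> U. \<sigma> x = (\<Sum>a<brank B. scl B (f a x) (e a x))))"

text \<open>The last conjunct says that any two frames are related by a smooth matrix.\<close>

definition vector_bundle ::
  "('m::topological_space, 'n::finite) chart set \<Rightarrow> ('m, 'v::ab_group_add) vbundle \<Rightarrow> bool"
where
  "vector_bundle A B \<longleftrightarrow>
     vector_space (scl B) \<and>
     (\<forall>x. module.subspace (scl B) (fibre B x)) \<and>
     (\<Union>(U, e)\<in>frames B. U) = UNIV \<and>
     (\<forall>(U, e)\<in>frames B. open U \<and>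
        (\<forall>x\<in>U. inj_on (\<lambda>a. e a x) {..<brank B} \<and>
           \<not> module.dependent (scl B) ((\<lambda>a. e a x) ` {..<brank B}) \<and>
           module.span (scl B) ((\<lambda>a. e a x) ` {..<brank B}) = fibre B x) \<and>
        (\<forall>a<brank B. bsection A B U (e a)))"

definition hermitian_metric ::
  "('m, 'n::finite) chart set \<Rightarrow> ('m, 'v::ab_group_add) vbundle \<Rightarrow> bool"
where
  "hermitian_metric A B \<longleftrightarrow>
     (\<forall>x. \<forall>v\<in>fibre B x. \<forall>w\<in>fibre B x.
        (\<forall>z\<in>fibre B x. herm B x (v + w) z = herm B x v z + herm B x w z) \<and>
        (\<forall>k. herm B x (scl B k v) w = k * herm B x v w) \<and>
        herm B x w v = cnj (herm B x v w) \<and>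
        (v \<noteq> 0 \<longrightarrow> Re (herm B x v v) > 0)) \<and>
     (\<forall>(U, e)\<in>frames B. \<forall>a<brank B. \<forall>b<brank B.
        smooth_fun A U (\<lambda>x. herm B x (e a x) (e b x)))"

definition hermitian_bundle ::
  "('m::topological_space, 'n::finite) chart set \<Rightarrow> ('m, 'v::ab_group_add) vbundle \<Rightarrow> bool"
where
  "hermitian_bundle A B \<longleftrightarrow> vector_bundle A B \<and> hermitian_metric A B"


section \<open>Bundle-valued forms\<close>

definition bundle_one_form ::
  "('m, 'n::finite) chart set \<Rightarrow> ('m, 'v::ab_group_add) vbundle \<Rightarrow> 'm set \<Rightarrow>
   ('m, 'n, 'v) form1 \<Rightarrow> bool"
where
  "bundle_one_form A B W \<omega> \<longleftrightarrow>
     (\<forall>c\<in>A. \<forall>x\<in>W \<inter> fst c.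
        (\<forall>u v. \<omega> c x (u + v) = \<omega> c x u + \<omega> c x v) \<and>
        (\<forall>k u. \<omega> c x (k *\<^sub>R u) = scl B (of_real k) (\<omega> c x u))) \<and>
     (\<forall>c\<in>A. \<forall>c'\<in>A. \<forall>x\<in>W \<inter> fst c \<inter> fst c'. \<forall>u. \<omega> c x u = \<omega> c' x (jac c c' x u)) \<and>
     (\<forall>c\<in>A. \<forall>u. bsection A B (W \<inter> fst c) (\<lambda>x. \<omega> c x u))"

definition antiherm_section ::
  "('m::topological_space, 'n::finite) chart set \<Rightarrow> ('m, 'v::ab_group_add) vbundle \<Rightarrow> 'm set \<Rightarrow>
   ('m \<Rightarrow> 'v \<Rightarrow> 'v) \<Rightarrow> bool"
where
  "antiherm_section A B W h \<longleftrightarrow>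
     (\<forall>x\<in>W. \<forall>v\<in>fibre B x. \<forall>w\<in>fibre B x.
        h x v \<in> fibre B x \<and>
        h x (v + w) = h x v + h x w \<and>
        (\<forall>k. h x (scl B k v) = scl B k (h x v)) \<and>
        herm B x (h x v) w = - herm B x v (h x w)) \<and>
     (\<forall>V \<sigma>. open V \<longrightarrow> V \<subseteq> W \<longrightarrow> bsection A B V \<sigma> \<longrightarrow> bsection A B V (\<lambda>x. h x (\<sigma> x)))"

definition antiherm_one_form ::
  "('m::topological_space, 'n::finite) chart set \<Rightarrow> ('m, 'v::ab_group_add) vbundle \<Rightarrow> 'm set \<Rightarrow>
   ('m, 'n, 'v \<Rightarrow> 'v) form1 \<Rightarrow> bool"
where
  "antiherm_one_form A B W E \<longleftrightarrow>
     (\<forall>c\<in>A. \<forall>x\<in>W \<inter> fst c. \<forall>w\<in>fibre B x.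
        (\<forall>u v. E c x (u + v) w = E c x u w + E c x v w) \<and>
        (\<forall>k u. E c x (k *\<^sub>R u) w = scl B (of_real k) (E c x u w))) \<and>
     (\<forall>c\<in>A. \<forall>c'\<in>A. \<forall>x\<in>W \<inter> fst c \<inter> fst c'. \<forall>w\<in>fibre B x. \<forall>u.
        E c x u w = E c' x (jac c c' x u) w) \<and>
     (\<forall>c\<in>A. \<forall>u. antiherm_section A B (W \<inter> fst c) (\<lambda>x. E c x u))"

text \<open>\<open>\<omega> = \<Sum>\<^sub>a \<beta>\<^sub>a \<otimes> \<sigma>\<^sub>a\<close> and \<open>E = \<Sum>\<^sub>a \<eta>\<^sub>a \<otimes> e\<^sub>a\<close> over \<^term>\<open>W\<close>.\<close>

definition section_tensor_rep ::
  "('m::topological_space, 'n::finite) chart set \<Rightarrow> ('m, 'v::ab_group_add) vbundle \<Rightarrow> 'm set \<Rightarrow>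
   ('m, 'n, 'v) form1 \<Rightarrow> nat \<Rightarrow> (nat \<Rightarrow> ('m, 'n, complex) form1) \<Rightarrow> (nat \<Rightarrow> 'm \<Rightarrow> 'v) \<Rightarrow> bool"
where
  "section_tensor_rep A B W \<omega> m \<beta> \<sigma> \<longleftrightarrow>
     open W \<and> (\<forall>a<m. one_form A W (\<beta> a) \<and> bsection A B W (\<sigma> a)) \<and>
     (\<forall>c\<in>A. \<forall>x\<in>W \<inter> fst c. \<forall>u. \<omega> c x u = (\<Sum>a<m. scl B (\<beta> a c x u) (\<sigma> a x)))"

definition antiherm_tensor_rep ::
  "('m::topological_space, 'n::finite) chart set \<Rightarrow> ('m, 'v::ab_group_add) vbundle \<Rightarrow> 'm set \<Rightarrow>
   ('m, 'n, 'v \<Rightarrow> 'v) form1 \<Rightarrow> nat \<Rightarrow> (nat \<Rightarrow> ('m, 'n, complex) form1) \<Rightarrow>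
   (nat \<Rightarrow> 'm \<Rightarrow> 'v \<Rightarrow> 'v) \<Rightarrow> bool"
where
  "antiherm_tensor_rep A B W E m \<eta> e \<longleftrightarrow>
     open W \<and> (\<forall>a<m. real_one_form A W (\<eta> a) \<and> antiherm_section A B W (e a)) \<and>
     (\<forall>c\<in>A. \<forall>x\<in>W \<inter> fst c. \<forall>u. \<forall>v\<in>fibre B x.
        E c x u v = (\<Sum>a<m. scl B (\<eta> a c x u) (e a x v)))"

text \<open>\<open>E \<and> E = \<Sum>\<^sub>a\<^sub>,\<^sub>b (\<eta>\<^sub>a \<and> \<eta>\<^sub>b) \<otimes> (e\<^sub>a \<circ> e\<^sub>b)\<close>, for any local decomposition
  \<open>E = \<Sum>\<^sub>a \<eta>\<^sub>a \<otimes> e\<^sub>a\<close> around the point, with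
  \<open>(\<eta> \<and> \<theta>)(u, v) = \<eta>(u) \<theta>(v) - \<eta>(v) \<theta>(u)\<close>. Here and in the definitions of the same
  shape below, decompositions exist locally and the value does not depend on the choice.\<close>

definition wedge_square ::
  "('m::topological_space, 'n::finite) chart set \<Rightarrow> ('m, 'v::ab_group_add) vbundle \<Rightarrow>
   ('m, 'n, 'v \<Rightarrow> 'v) form1 \<Rightarrow>
   ('m, 'n) chart \<Rightarrow> 'm \<Rightarrow> real ^ 'n \<Rightarrow> real ^ 'n \<Rightarrow> 'v \<Rightarrow> 'v"
where
  "wedge_square A B E c x u v f =
     (THE w. \<exists>W m \<eta> e. antiherm_tensor_rep A B W E m \<eta> e \<and> x \<in> W \<and>
        w = (\<Sum>a<m. \<Sum>b<m.
               scl B (\<eta> a c x u * \<eta> b c x v - \<eta> a c x v * \<eta> b c x u) (e a x (e b x f))))"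


section \<open>Connections\<close>

text \<open>A morphism of sheaves from sections to bundle-valued one-forms is represented by one operator
  on functions whose value at a point depends only on the germ of the section there; it is
  constrained only where its argument is a smooth section.\<close>

type_synonym ('m, 'n, 'v) sheaf_op = "('m \<Rightarrow> 'v) \<Rightarrow> ('m, 'n, 'v) form1"

definition connection ::
  "('m::topological_space, 'n::finite) chart set \<Rightarrow> ('m, 'v::ab_group_add) vbundle \<Rightarrow>
   ('m, 'n, 'v) sheaf_op \<Rightarrow> bool"
where
  "connection A B D \<longleftrightarrow>
     (\<forall>W \<sigma>. open W \<longrightarrow> bsection A B W \<sigma> \<longrightarrow>
        bundle_one_form A B W (D \<sigma>) \<and>
        (\<forall>\<tau>. bsection A B W \<tau> \<longrightarrow> (\<forall>x\<in>W. \<sigma> x = \<tau> x) \<longrightarrow>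
           (\<forall>c\<in>A. \<forall>x\<in>W \<inter> fst c. \<forall>u. D \<sigma> c x u = D \<tau> c x u)) \<and>
        (\<forall>\<tau>. bsection A B W \<tau> \<longrightarrow>
           (\<forall>c\<in>A. \<forall>x\<in>W \<inter> fst c. \<forall>u. D (\<lambda>z. \<sigma> z + \<tau> z) c x u = D \<sigma> c x u + D \<tau> c x u)) \<and>
        (\<forall>f :: 'm \<Rightarrow> complex. smooth_fun A W f \<longrightarrow>
           (\<forall>c\<in>A. \<forall>x\<in>W \<inter> fst c. \<forall>u.
              D (\<lambda>z. scl B (f z) (\<sigma> z)) c x u =
              scl B (d0 f c x u) (\<sigma> x) + scl B (f x) (D \<sigma> c x u))))"

definition hermitian_connection ::
  "('m::topological_space, 'n::finite) chart set \<Rightarrow> ('m, 'v::ab_group_add) vbundle \<Rightarrow>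
   ('m, 'n, 'v) sheaf_op \<Rightarrow> bool"
where
  "hermitian_connection A B D \<longleftrightarrow>
     connection A B D \<and>
     (\<forall>W \<sigma> \<tau>. open W \<longrightarrow> bsection A B W \<sigma> \<longrightarrow> bsection A B W \<tau> \<longrightarrow>
        (\<forall>c\<in>A. \<forall>x\<in>W \<inter> fst c. \<forall>u.
           herm B x (D \<sigma> c x u) (\<tau> x) + herm B x (\<sigma> x) (D \<tau> c x u) =
           d0 (\<lambda>z. herm B z (\<sigma> z) (\<tau> z)) c x u))"

text \<open>The operator \<open>\<nabla> + \<E>\<close> with \<open>\<E>(\<sigma>) = \<Sum>\<^sub>a \<eta>\<^sub>a \<otimes> e\<^sub>a(\<sigma>)\<close> for \<open>E = \<Sum>\<^sub>a \<eta>\<^sub>a \<otimes> e\<^sub>a\<close>.\<close>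

definition add_form ::
  "('m, 'n, 'v::ab_group_add) sheaf_op \<Rightarrow> ('m, 'n, 'v \<Rightarrow> 'v) form1 \<Rightarrow> ('m, 'n, 'v) sheaf_op"
where
  "add_form D E \<sigma> c x u = D \<sigma> c x u + E c x u (\<sigma> x)"

text \<open>The extension of a connection to one-forms,
  \<open>\<nabla>\<^sup>1(\<beta> \<otimes> \<sigma>) = d\<beta> \<otimes> \<sigma> - \<beta> \<and> \<nabla>\<sigma>\<close>, summed over any local decomposition around the point.\<close>

definition conn1 ::
  "('m::topological_space, 'n::finite) chart set \<Rightarrow> ('m, 'v::ab_group_add) vbundle \<Rightarrow>
   ('m, 'n, 'v) sheaf_op \<Rightarrow> ('m, 'n, 'v) form1 \<Rightarrow>
   ('m, 'n) chart \<Rightarrow> 'm \<Rightarrow> real ^ 'n \<Rightarrow> real ^ 'n \<Rightarrow> 'v"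
where
  "conn1 A B D \<omega> c x u v =
     (THE w. \<exists>W m \<beta> \<sigma>. section_tensor_rep A B W \<omega> m \<beta> \<sigma> \<and> x \<in> W \<and>
        w = (\<Sum>a<m. scl B (d1 (\<beta> a) c x u v) (\<sigma> a x) -
               (scl B (\<beta> a c x u) (D (\<sigma> a) c x v) - scl B (\<beta> a c x v) (D (\<sigma> a) c x u))))"

definition flat ::
  "('m::topological_space, 'n::finite) chart set \<Rightarrow> ('m, 'v::ab_group_add) vbundle \<Rightarrow>
   ('m, 'n, 'v) sheaf_op \<Rightarrow> bool"
where
  "flat A B D \<longleftrightarrow>
     (\<forall>W \<sigma>. open W \<longrightarrow> bsection A B W \<sigma> \<longrightarrow>
        (\<forall>c\<in>A. \<forall>x\<in>W \<inter> fst c. \<forall>u v. conn1 A B D (D \<sigma>) c x u v = 0))"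

text \<open>\<open>\<nabla> \<circ> h - h \<circ> \<nabla>\<close>\<close>

definition commutator ::
  "('m, 'n, 'v::ab_group_add) sheaf_op \<Rightarrow> ('m \<Rightarrow> 'v \<Rightarrow> 'v) \<Rightarrow> ('m, 'n, 'v) sheaf_op"
where
  "commutator D h \<sigma> c x u = D (\<lambda>z. h z (\<sigma> z)) c x u - h x (D \<sigma> c x u)"

text \<open>The induced connection on endomorphism-valued one-forms,
  \<open>\<nabla>(\<eta> \<otimes> h) = d\<eta> \<otimes> h - \<eta> \<and> (\<nabla> \<circ> h - h \<circ> \<nabla>)\<close>, summed over any local decomposition around the
  point. The resulting endomorphism-valued two-form is given by its action on sections.\<close>

definition end_conn1 ::
  "('m::topological_space, 'n::finite) chart set \<Rightarrow> ('m, 'v::ab_group_add) vbundle \<Rightarrow>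
   ('m, 'n, 'v) sheaf_op \<Rightarrow> ('m, 'n, 'v \<Rightarrow> 'v) form1 \<Rightarrow> ('m \<Rightarrow> 'v) \<Rightarrow>
   ('m, 'n) chart \<Rightarrow> 'm \<Rightarrow> real ^ 'n \<Rightarrow> real ^ 'n \<Rightarrow> 'v"
where
  "end_conn1 A B D E \<sigma> c x u v =
     (THE w. \<exists>W m \<eta> e. antiherm_tensor_rep A B W E m \<eta> e \<and> x \<in> W \<and>
        w = (\<Sum>a<m. scl B (d1 (\<eta> a) c x u v) (e a x (\<sigma> x)) -
               (scl B (\<eta> a c x u) (commutator D (e a) \<sigma> c x v) -
                scl B (\<eta> a c x v) (commutator D (e a) \<sigma> c x u))))"

text \<open>\<open>C\<^sub>E = \<nabla>E\<^sub>2 + E\<^sub>1 \<and> E\<^sub>1\<close>, acting on sections.\<close>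

definition C_E ::
  "('m::topological_space, 'n::finite) chart set \<Rightarrow> ('m, 'v::ab_group_add) vbundle \<Rightarrow>
   ('m, 'n, 'v) sheaf_op \<Rightarrow> ('m, 'n, 'v \<Rightarrow> 'v) form1 \<Rightarrow> ('m, 'n, 'v \<Rightarrow> 'v) form1 \<Rightarrow>
   ('m \<Rightarrow> 'v) \<Rightarrow> ('m, 'n) chart \<Rightarrow> 'm \<Rightarrow> real ^ 'n \<Rightarrow> real ^ 'n \<Rightarrow> 'v"
where
  "C_E A B D E\<^sub>1 E\<^sub>2 \<sigma> c x u v =
     end_conn1 A B D E\<^sub>2 \<sigma> c x u v + wedge_square A B E\<^sub>1 c x u v (\<sigma> x)"

text \<open>A morphism on sections with values in two-forms vanishes.\<close>

definition zero_on_sections ::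
  "('m::topological_space, 'n::finite) chart set \<Rightarrow> ('m, 'v::ab_group_add) vbundle \<Rightarrow>
   (('m \<Rightarrow> 'v) \<Rightarrow> ('m, 'n) chart \<Rightarrow> 'm \<Rightarrow> real ^ 'n \<Rightarrow> real ^ 'n \<Rightarrow> 'v) \<Rightarrow> bool"
where
  "zero_on_sections A B T \<longleftrightarrow>
     (\<forall>W \<sigma>. open W \<longrightarrow> bsection A B W \<sigma> \<longrightarrow>
        (\<forall>c\<in>A. \<forall>x\<in>W \<inter> fst c. \<forall>u v. T \<sigma> c x u v = 0))"


section \<open>The smooth topology on endomorphism-valued one-forms\<close>

text \<open>Matrix coefficients with respect to a chart and a frame. As the Gram matrix of a frame is smooth
  and invertible, they determine the same topology as the entries of the matrix of
  \<^term>\<open>E c x u\<close>.\<close>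

definition mcoeff ::
  "('m, 'v) vbundle \<Rightarrow> ('m, 'n, 'v \<Rightarrow> 'v) form1 \<Rightarrow> ('m, 'n) chart \<Rightarrow> (nat \<Rightarrow> 'm \<Rightarrow> 'v) \<Rightarrow>
   real ^ 'n \<Rightarrow> nat \<Rightarrow> nat \<Rightarrow> real ^ 'n \<Rightarrow> complex"
where
  "mcoeff B E c e u a b = in_chart c (\<lambda>x. herm B x (E c x u (e a x)) (e b x))"

text \<open>Uniform convergence on compact sets of all derivatives.\<close>

definition smooth_limit ::
  "('m, 'n::finite) chart set \<Rightarrow> ('m, 'v) vbundle \<Rightarrow>
   (real \<Rightarrow> ('m, 'n, 'v \<Rightarrow> 'v) form1) \<Rightarrow> ('m, 'n, 'v \<Rightarrow> 'v) form1 \<Rightarrow> real filter \<Rightarrow> bool"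
where
  "smooth_limit A B G L F \<longleftrightarrow>
     (\<forall>c\<in>A. \<forall>(U, e)\<in>frames B. \<forall>u. \<forall>a<brank B. \<forall>b<brank B. \<forall>K vs.
        compact K \<longrightarrow> K \<subseteq> snd c ` (fst c \<inter> U) \<longrightarrow>
        uniform_limit K (\<lambda>t. ideriv vs (mcoeff B (G t) c e u a b))
          (ideriv vs (mcoeff B L c e u a b)) F)"

text \<open>\<open>G(t) = O(p(t))\<close> in each of the defining seminorms of this topology.\<close>

definition smooth_bigo ::
  "('m, 'n::finite) chart set \<Rightarrow> ('m, 'v) vbundle \<Rightarrow>
   (real \<Rightarrow> ('m, 'n, 'v \<Rightarrow> 'v) form1) \<Rightarrow> (real \<Rightarrow> real) \<Rightarrow> real filter \<Rightarrow> bool"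
where
  "smooth_bigo A B G p F \<longleftrightarrow>
     (\<forall>c\<in>A. \<forall>(U, e)\<in>frames B. \<forall>u. \<forall>a<brank B. \<forall>b<brank B. \<forall>K vs.
        compact K \<longrightarrow> K \<subseteq> snd c ` (fst c \<inter> U) \<longrightarrow>
        (\<exists>C. \<forall>\<^sub>F t in F. \<forall>y\<in>K. norm (ideriv vs (mcoeff B (G t) c e u a b) y) \<le> C * \<bar>p t\<bar>))"

definition form_scale ::
  "('m, 'v) vbundle \<Rightarrow> real \<Rightarrow> ('m, 'n, 'v \<Rightarrow> 'v) form1 \<Rightarrow> ('m, 'n, 'v \<Rightarrow> 'v) form1"
where
  "form_scale B k E c x u v = scl B (of_real k) (E c x u v)"

definition form_diff ::
  "('m, 'n, 'v::ab_group_add \<Rightarrow> 'v) form1 \<Rightarrow> ('m, 'n, 'v \<Rightarrow> 'v) form1 \<Rightarrow> ('m, 'n, 'v \<Rightarrow> 'v) form1"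
where
  "form_diff E E' c x u v = E c x u v - E' c x u v"

end

theory Submission
  imports Defs
begin

text \<open>On constant coordinate fields \<open>u\<close>, \<open>v\<close> of a chart, whose bracket vanishes, every operator built
  from tensor decompositions becomes a commutator:
  \<open>(\<nabla>\<^sup>1\<omega>)(u, v) = \<nabla>\<^sub>u \<omega>\<^sub>v - \<nabla>\<^sub>v \<omega>\<^sub>u\<close>, \<open>(\<nabla>E)(u, v) = [\<nabla>\<^sub>u, E\<^sub>v] - [\<nabla>\<^sub>v, E\<^sub>u]\<close> and
  \<open>(E \<and> E)(u, v) = [E\<^sub>u, E\<^sub>v]\<close>. Hence flatness of \<open>\<nabla>\<close> and of \<open>\<nabla> + E(t)\<close> gives
  \<open>\<nabla>E(t) + E(t) \<and> E(t) = 0\<close>. Dividing by \<open>t\<close> and letting \<open>t\<close> tend to \<open>0\<close> yields \<open>\<nabla>E\<^sub>1 = 0\<close>; dividing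
  \<open>\<nabla>(E(t) - tE\<^sub>1) + E(t) \<and> E(t) = 0\<close> by \<open>t\<^sup>2\<close> then yields \<open>\<nabla>E\<^sub>2 + E\<^sub>1 \<and> E\<^sub>1 = 0\<close>. The limits are taken
  in the matrix coefficients with respect to a local frame, where \<open>\<langle>\<nabla>\<^sub>u(E\<^sub>v e\<^sub>a), e\<^sub>b\<rangle>\<close> is the derivative
  of a coefficient minus \<open>\<langle>E\<^sub>v e\<^sub>a, \<nabla>\<^sub>u e\<^sub>b\<rangle>\<close>; tensoriality extends the result to all sections.\<close>

section \<open>Calculus of smooth maps\<close>

text \<open>\<open>frechet_derivative\<close> is chosen from the predicate
  \<open>has_derivative\<close>, so it suffices that both functions satisfy this predicate for the
  same candidates. This also covers points where they are not differentiable.\<close>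

lemma frechet_derivative_cong_open:
  assumes "open S" "y \<in> S" "\<And>z. z \<in> S \<Longrightarrow> f z = g z"
  shows "frechet_derivative f (at y) = frechet_derivative g (at y)"
proof -
  have "(f has_derivative f') (at y) \<longleftrightarrow> (g has_derivative f') (at y)" for f'
    using has_derivative_transform_within_open[OF _ assms(1,2), of f f' UNIV g]
      has_derivative_transform_within_open[OF _ assms(1,2), of g f' UNIV f] assms(3) by auto
  then show ?thesis
    by (simp add: frechet_derivative_def)
qed

lemma differentiable_cong_open:
  assumes "open S" "y \<in> S" "\<And>z. z \<in> S \<Longrightarrow> f z = g z" "f differentiable (at y)"
  shows "g differentiable (at y)"
  using assms has_derivative_transform_within_open[OF _ assms(1,2)]
  unfolding differentiable_def by blast

lemma ideriv_append: "ideriv (vs @ ws) f = ideriv vs (ideriv ws f)"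
  by (induction vs) auto

lemma ideriv_cong_open:
  assumes "open S" "\<And>z. z \<in> S \<Longrightarrow> f z = g z" "y \<in> S"
  shows "ideriv vs f y = ideriv vs g y"
  using assms(3)
proof (induction vs arbitrary: y)
  case (Cons v vs)
  then show ?case
    using frechet_derivative_cong_open[OF assms(1) Cons.prems, of "ideriv vs f" "ideriv vs g"] by simp
qed (use assms in auto)

lemma smooth_on_cong:
  assumes "open S" "\<And>z. z \<in> S \<Longrightarrow> f z = g z" "smooth_on S f"
  shows "smooth_on S g"
  unfolding smooth_on_def
proof (intro allI ballI)
  fix vs y assume "y \<in> S"
  then show "ideriv vs g differentiable (at y)"
    using differentiable_cong_open[OF assms(1) \<open>y \<in> S\<close>, of "ideriv vs f" "ideriv vs g"]
      ideriv_cong_open[of S f g, OF assms(1,2)] assms(3)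
    unfolding smooth_on_def by blast
qed

lemma smooth_on_mono: "smooth_on S f \<Longrightarrow> T \<subseteq> S \<Longrightarrow> smooth_on T f"
  unfolding smooth_on_def by blast

lemma smooth_on_differentiable: "smooth_on S f \<Longrightarrow> y \<in> S \<Longrightarrow> f differentiable (at y)"
  unfolding smooth_on_def by (metis ideriv.simps(1))

lemma smooth_on_has_derivative:
  "smooth_on S f \<Longrightarrow> y \<in> S \<Longrightarrow> (f has_derivative frechet_derivative f (at y)) (at y)"
  by (meson smooth_on_differentiable frechet_derivative_works)

lemma smooth_on_frechet_derivative:
  assumes "smooth_on S f"
  shows "smooth_on S (\<lambda>y. frechet_derivative f (at y) v)"
proof -
  \<comment> \<open>\<open>ideriv\<close> differentiates along the last list entry first, so a
    derivative already taken goes to the end of the list.\<close>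
  have "ideriv vs (\<lambda>y. frechet_derivative f (at y) v) = ideriv (vs @ [v]) f" for vs
    by (simp add: ideriv_append)
  then show ?thesis
    using assms unfolding smooth_on_def by metis
qed

text \<open>Iterated derivatives never leave a class of differentiable functions that is stable
  under directional derivatives. Agreement with a member of the class is asked only on
  \<open>S\<close>; openness lets it survive further differentiation.\<close>

lemma smooth_on_coinduct:
  assumes S: "open S" and f: "Q f"
    and diff: "\<And>f y. Q f \<Longrightarrow> y \<in> S \<Longrightarrow> f differentiable (at y)"
    and step: "\<And>f v. Q f \<Longrightarrow> \<exists>g. Q g \<and> (\<forall>y\<in>S. frechet_derivative f (at y) v = g y)"
  shows "smooth_on S f"
proof -
  have *: "\<exists>g. Q g \<and> (\<forall>y\<in>S. ideriv vs f y = g y)" for vs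
  proof (induction vs)
    case Nil
    then show ?case using f by auto
  next
    case (Cons v vs)
    then obtain g where g: "Q g" "\<And>y. y \<in> S \<Longrightarrow> ideriv vs f y = g y" by blast
    from step[OF g(1), of v] obtain h where h: "Q h" "\<And>y. y \<in> S \<Longrightarrow> frechet_derivative g (at y) v = h y"
      by blast
    show ?case
      using h frechet_derivative_cong_open[OF S _ g(2)] by auto
  qed
  show ?thesis
    unfolding smooth_on_def
  proof (intro allI ballI)
    fix vs y assume y: "y \<in> S"
    from *[of vs] obtain g where "Q g" "\<And>y. y \<in> S \<Longrightarrow> ideriv vs f y = g y" by blast
    then show "ideriv vs f differentiable (at y)"
      using differentiable_cong_open[OF S y _ diff, of g "ideriv vs f"] y by auto
  qed
qed

section \<open>Stability of smoothness under linear maps, sums, products and composition\<close>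

lemma smooth_on_bounded_linear:
  assumes S: "open S" and L: "bounded_linear L" and f: "smooth_on S f"
  shows "smooth_on S (\<lambda>y. L (f y))"
proof -
  define Q where "Q h \<longleftrightarrow> (\<exists>f. smooth_on S f \<and> h = (\<lambda>y. L (f y)))" for h
  have D: "((\<lambda>y. L (f y)) has_derivative (\<lambda>v. L (frechet_derivative f (at y) v))) (at y)"
    if "smooth_on S f" "y \<in> S" for f y
    using bounded_linear.has_derivative[OF L smooth_on_has_derivative[OF that]] .
  show ?thesis
  proof (rule smooth_on_coinduct[OF S, of Q])
    show "Q (\<lambda>y. L (f y))" using f Q_def by auto
    show "h differentiable (at y)" if "Q h" "y \<in> S" for h y
      using that D unfolding Q_def differentiable_def by blast
    show "\<exists>g. Q g \<and> (\<forall>y\<in>S. frechet_derivative h (at y) v = g y)" if "Q h" for h v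
    proof -
      from that obtain f where f: "smooth_on S f" "h = (\<lambda>y. L (f y))" unfolding Q_def by blast
      show ?thesis
        using frechet_derivative_at[OF D[OF f(1)], symmetric] smooth_on_frechet_derivative[OF f(1)] f(2)
        unfolding Q_def by (intro exI[of _ "\<lambda>y. L (frechet_derivative f (at y) v)"]) auto
    qed
  qed
qed

lemma smooth_on_const: "smooth_on (S :: 'a::real_normed_vector set) (\<lambda>y. k)"
proof -
  have "\<exists>k'. ideriv vs (\<lambda>y. k) = (\<lambda>y. k')" for vs :: "'a list"
  proof (induction vs)
    case (Cons v vs)
    then obtain k' where "ideriv vs (\<lambda>y. k) = (\<lambda>y. k')" by blast
    then show ?case by (auto simp: frechet_derivative_const)
  qed auto
  then show ?thesis
    unfolding smooth_on_def by (metis differentiable_const)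
qed

lemma smooth_on_add:
  fixes f g :: "'a::real_normed_vector \<Rightarrow> 'b::real_normed_vector"
  assumes S: "open S" and f: "smooth_on S f" and g: "smooth_on S g"
  shows "smooth_on S (\<lambda>y. f y + g y)"
proof -
  define Q where "Q h \<longleftrightarrow> (\<exists>f g. smooth_on S f \<and> smooth_on S g \<and> h = (\<lambda>y. f y + g y))"
    for h :: "'a \<Rightarrow> 'b"
  have D: "((\<lambda>y. f y + g y) has_derivative
      (\<lambda>v. frechet_derivative f (at y) v + frechet_derivative g (at y) v)) (at y)"
    if "smooth_on S f" "smooth_on S g" "y \<in> S" for f g :: "'a \<Rightarrow> 'b" and y
    using has_derivative_add[OF smooth_on_has_derivative[OF that(1,3)] smooth_on_has_derivative[OF that(2,3)]] .
  show ?thesis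
  proof (rule smooth_on_coinduct[OF S, of Q])
    show "Q (\<lambda>y. f y + g y)" using f g Q_def by auto
    show "h differentiable (at y)" if "Q h" "y \<in> S" for h y
      using that D unfolding Q_def differentiable_def by blast
    show "\<exists>g. Q g \<and> (\<forall>y\<in>S. frechet_derivative h (at y) v = g y)" if "Q h" for h v
    proof -
      from that obtain f g where f: "smooth_on S f" "smooth_on S g" "h = (\<lambda>y. f y + g y)"
        unfolding Q_def by blast
      show ?thesis
        using frechet_derivative_at[OF D[OF f(1,2)], symmetric] f(3)
          smooth_on_frechet_derivative[OF f(1), of v] smooth_on_frechet_derivative[OF f(2), of v]
        unfolding Q_def
        by (intro exI[of _ "\<lambda>y. frechet_derivative f (at y) v + frechet_derivative g (at y) v"])
          (simp, blast)
    qed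
  qed
qed

text \<open>The span of the products \<open>p \<cdot> (f \<circ> \<phi>)\<close> is closed under directional derivatives.\<close>

inductive comp_sums ::
  "'a set \<Rightarrow> 'c set \<Rightarrow> ('a \<Rightarrow> 'c::real_normed_vector) \<Rightarrow>
   ('a::real_normed_vector \<Rightarrow> 'b::real_normed_algebra) \<Rightarrow> bool"
  for S T \<phi> where
  base: "smooth_on S p \<Longrightarrow> smooth_on T f \<Longrightarrow> comp_sums S T \<phi> (\<lambda>y. p y * f (\<phi> y))"
| zero: "comp_sums S T \<phi> (\<lambda>y. 0)"
| add: "comp_sums S T \<phi> a \<Longrightarrow> comp_sums S T \<phi> b \<Longrightarrow> comp_sums S T \<phi> (\<lambda>y. a y + b y)"

lemma comp_sums_sum:
  "(\<And>i. i \<in> I \<Longrightarrow> comp_sums S T \<phi> (f i)) \<Longrightarrow> comp_sums S T \<phi> (\<lambda>y. \<Sum>i\<in>I. f i y)"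
  by (induction I rule: infinite_finite_induct) (auto intro: comp_sums.intros)

text \<open>Sums differentiate termwise, so only a single product has to be examined. One induction
  then serves both the product rule, where \<phi> is the identity, and the chain rule.\<close>

lemma comp_sums_smooth_on:
  fixes h :: "'a::real_normed_vector \<Rightarrow> 'b::real_normed_algebra"
    and \<phi> :: "'a \<Rightarrow> 'c::real_normed_vector"
  assumes S: "open S" and h: "comp_sums S T \<phi> h"
    and D: "\<And>(p :: 'a \<Rightarrow> 'b) (f :: 'c \<Rightarrow> 'b) y. smooth_on S p \<Longrightarrow> smooth_on T f \<Longrightarrow> y \<in> S \<Longrightarrow> (\<lambda>y. p y * f (\<phi> y)) differentiable (at y)"
    and step: "\<And>(p :: 'a \<Rightarrow> 'b) (f :: 'c \<Rightarrow> 'b) v. smooth_on S p \<Longrightarrow> smooth_on T f \<Longrightarrow>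
      \<exists>g. comp_sums S T \<phi> g \<and> (\<forall>y\<in>S. frechet_derivative (\<lambda>y. p y * f (\<phi> y)) (at y) v = g y)"
  shows "smooth_on S h"
proof -
  have diff: "\<forall>y\<in>S. h differentiable (at y)" if "comp_sums S T \<phi> h" for h :: "'a \<Rightarrow> 'b"
    using that by induction (auto intro: D)
  show ?thesis
  proof (rule smooth_on_coinduct[OF S, of "comp_sums S T \<phi>", OF h])
    show "h differentiable (at y)" if "comp_sums S T \<phi> h" "y \<in> S" for h :: "'a \<Rightarrow> 'b" and y
      using that diff by blast
    show "\<exists>g. comp_sums S T \<phi> g \<and> (\<forall>y\<in>S. frechet_derivative h (at y) v = g y)"
      if "comp_sums S T \<phi> h" for h :: "'a \<Rightarrow> 'b" and v
      using that
    proof induction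
      case (base p f)
      then show ?case using step by blast
    next
      case zero
      show ?case by (intro exI[of _ "\<lambda>y. 0"]) (auto intro: comp_sums.zero simp: frechet_derivative_const)
    next
      case (add a b)
      then obtain g h where
        "comp_sums S T \<phi> g" "\<forall>y\<in>S. frechet_derivative a (at y) v = g y"
        "comp_sums S T \<phi> h" "\<forall>y\<in>S. frechet_derivative b (at y) v = h y" by blast
      moreover have "frechet_derivative (\<lambda>y. a y + b y) (at y) =
          (\<lambda>v. frechet_derivative a (at y) v + frechet_derivative b (at y) v)" if "y \<in> S" for y
        using diff add.hyps that
        by (intro frechet_derivative_at[symmetric] has_derivative_add iffD1[OF frechet_derivative_works]) auto
      ultimately show ?case
        by (intro exI[of _ "\<lambda>y. g y + h y"]) (auto intro: comp_sums.add)
    qed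
  qed
qed

lemma smooth_on_mult:
  fixes f g :: "'a::real_normed_vector \<Rightarrow> 'b::real_normed_algebra"
  assumes S: "open S" and f: "smooth_on S f" and g: "smooth_on S g"
  shows "smooth_on S (\<lambda>y. f y * g y)"
proof -
  have D: "((\<lambda>y. p y * f y) has_derivative
      (\<lambda>v. p y * frechet_derivative f (at y) v + frechet_derivative p (at y) v * f y)) (at y)"
    if "smooth_on S p" "smooth_on S f" "y \<in> S" for p f :: "'a \<Rightarrow> 'b" and y
    using has_derivative_mult[OF smooth_on_has_derivative[OF that(1,3)] smooth_on_has_derivative[OF that(2,3)]] .
  show ?thesis
  proof (rule comp_sums_smooth_on[OF S, of S "\<lambda>y. y"])
    show "comp_sums S S (\<lambda>y. y) (\<lambda>y. f y * g y)"
      using f g by (rule comp_sums.base)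
    show "(\<lambda>y. p y * f y) differentiable (at y)"
      if "smooth_on S p" "smooth_on S f" "y \<in> S" for p f :: "'a \<Rightarrow> 'b" and y
      using D[OF that] by (auto simp: differentiable_def)
    show "\<exists>g. comp_sums S S (\<lambda>y. y) g \<and> (\<forall>y\<in>S. frechet_derivative (\<lambda>y. p y * f y) (at y) v = g y)"
      if "smooth_on S p" "smooth_on S f" for p f :: "'a \<Rightarrow> 'b" and v
      using frechet_derivative_at[OF D[OF that], symmetric] that
      by (intro exI[of _ "\<lambda>y. p y * frechet_derivative f (at y) v + frechet_derivative p (at y) v * f y"])
        (auto intro!: comp_sums.add comp_sums.base[where \<phi>="\<lambda>y. y"] smooth_on_frechet_derivative)
  qed
qed

text \<open>In the chain rule the direction \<open>frechet_derivative \<phi> (at y) v\<close> varies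
  with the point. Expanding it in the Euclidean basis leaves derivatives of \<open>f\<close> in
  constant directions, composed with \<phi>, with smooth coefficients: again a member of
  \<open>comp_sums\<close>.\<close>

lemma smooth_on_compose:
  fixes f :: "'c::euclidean_space \<Rightarrow> 'b::real_normed_field" and \<phi> :: "'a::real_normed_vector \<Rightarrow> 'c"
  assumes S: "open S" and \<phi>: "smooth_on S \<phi>" and T: "\<phi> ` S \<subseteq> T" and f: "smooth_on T f"
  shows "smooth_on S (\<lambda>y. f (\<phi> y))"
proof -
  have fD: "((\<lambda>y. f (\<phi> y)) has_derivative (\<lambda>v. frechet_derivative f (at (\<phi> y)) (frechet_derivative \<phi> (at y) v))) (at y)"
    if "smooth_on T f" "y \<in> S" for f :: "'c \<Rightarrow> 'b" and y
    using has_derivative_compose[OF smooth_on_has_derivative[OF \<phi> that(2)]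
        smooth_on_has_derivative[OF that(1), of "\<phi> y"]] T that(2) by auto
  have D: "((\<lambda>y. p y * f (\<phi> y)) has_derivative
      (\<lambda>v. p y * frechet_derivative f (at (\<phi> y)) (frechet_derivative \<phi> (at y) v) +
        frechet_derivative p (at y) v * f (\<phi> y))) (at y)"
    if "smooth_on S p" "smooth_on T f" "y \<in> S" for p :: "'a \<Rightarrow> 'b" and f y
    using has_derivative_mult[OF smooth_on_has_derivative[OF that(1,3)] fD[OF that(2,3)]] .
  have basis: "frechet_derivative f (at (\<phi> y)) w =
      (\<Sum>i\<in>Basis. of_real (w \<bullet> i) * frechet_derivative f (at (\<phi> y)) i)"
    if "smooth_on T f" "y \<in> S" for f :: "'c \<Rightarrow> 'b" and y w
  proof -
    have "linear (frechet_derivative f (at (\<phi> y)))" (is "linear ?f'")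
      using smooth_on_differentiable[OF that(1)] that(2) T by (auto intro: linear_frechet_derivative)
    then have "?f' (\<Sum>i\<in>Basis. (w \<bullet> i) *\<^sub>R i) = (\<Sum>i\<in>Basis. of_real (w \<bullet> i) * ?f' i)"
      by (simp add: linear_sum linear_scale scaleR_conv_of_real)
    then show ?thesis
      by (simp add: euclidean_representation)
  qed
  \<comment> \<open>The factor 1 gives the composite the shape of a generator of
    \<open>comp_sums\<close>.\<close>
  have "smooth_on S (\<lambda>y. 1 * f (\<phi> y))"
  proof (rule comp_sums_smooth_on[OF S, of T \<phi>])
    show "comp_sums S T \<phi> (\<lambda>y. 1 * f (\<phi> y))"
      using comp_sums.base[OF smooth_on_const f] .
    show "(\<lambda>y. p y * f (\<phi> y)) differentiable (at y)"
      if "smooth_on S p" "smooth_on T f" "y \<in> S" for p :: "'a \<Rightarrow> 'b" and f y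
      using D[OF that] by (auto simp: differentiable_def)
    show "\<exists>g. comp_sums S T \<phi> g \<and> (\<forall>y\<in>S. frechet_derivative (\<lambda>y. p y * f (\<phi> y)) (at y) v = g y)"
      if that: "smooth_on S p" "smooth_on T f" for p :: "'a \<Rightarrow> 'b" and f v
    proof (intro exI conjI ballI)
      have "smooth_on S (\<lambda>y. p y * of_real (frechet_derivative \<phi> (at y) v \<bullet> i))" for i
        by (intro smooth_on_mult S that smooth_on_bounded_linear[OF S bounded_linear_of_real]
            smooth_on_bounded_linear[OF S bounded_linear_inner_left] smooth_on_frechet_derivative \<phi>)
      then have "comp_sums S T \<phi> (\<lambda>y. p y * of_real (frechet_derivative \<phi> (at y) v \<bullet> i) *
          frechet_derivative f (at (\<phi> y)) i)" for i
        using comp_sums.base[OF _ smooth_on_frechet_derivative[OF that(2), of i]] by blast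
      from comp_sums.add[OF comp_sums_sum[OF this]
          comp_sums.base[OF smooth_on_frechet_derivative[OF that(1), of v] that(2)]]
      show "comp_sums S T \<phi> (\<lambda>y. (\<Sum>i\<in>Basis. p y * of_real (frechet_derivative \<phi> (at y) v \<bullet> i) *
          frechet_derivative f (at (\<phi> y)) i) + frechet_derivative p (at y) v * f (\<phi> y))" .
      show "frechet_derivative (\<lambda>y. p y * f (\<phi> y)) (at y) v =
         (\<Sum>i\<in>Basis. p y * of_real (frechet_derivative \<phi> (at y) v \<bullet> i) *
          frechet_derivative f (at (\<phi> y)) i) + frechet_derivative p (at y) v * f (\<phi> y)" if "y \<in> S" for y
        unfolding frechet_derivative_at[OF D[OF \<open>smooth_on S p\<close> \<open>smooth_on T f\<close> that], symmetric]
          basis[OF \<open>smooth_on T f\<close> that, of "frechet_derivative \<phi> (at y) v"]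
        by (simp add: sum_distrib_left mult.assoc)
    qed
  qed
  then show ?thesis by simp
qed


section \<open>Functions and one-forms on manifolds\<close>

lemma smooth_fun_mono: "smooth_fun A W f \<Longrightarrow> W' \<subseteq> W \<Longrightarrow> smooth_fun A W' f"
  unfolding smooth_fun_def by (blast intro: smooth_on_mono)

lemma smooth_fun_const: "smooth_fun A W (\<lambda>x. k)"
  unfolding smooth_fun_def in_chart_def by (simp add: smooth_on_const)

lemma d0_const: "d0 (\<lambda>x. k) c x u = 0"
  unfolding d0_def in_chart_def by (simp add: frechet_derivative_const)

text \<open>Complex valued because \<open>one_form\<close> is. The differentials of these functions
  are the forms dx_i of the coordinate decompositions below.\<close>

definition chart_coord :: "('m, 'n::finite) chart \<Rightarrow> 'n \<Rightarrow> 'm \<Rightarrow> complex" where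
  "chart_coord c i x = of_real (snd c x $ i)"

locale smooth_manifold =
  fixes A :: "('m::{t2_space, second_countable_topology}, 'n::finite) chart set"
  assumes atlas: "smooth_atlas A"
begin

lemma chart_homeomorphism:
  "c \<in> A \<Longrightarrow> homeomorphism (fst c) (snd c ` fst c) (snd c) (inv_into (fst c) (snd c))"
  using atlas unfolding smooth_atlas_def by blast

lemma open_chart: "c \<in> A \<Longrightarrow> open (fst c)"
  using atlas unfolding smooth_atlas_def by blast

lemma open_chart_image: assumes c: "c \<in> A" and W: "open W" shows "open (snd c ` (W \<inter> fst c))"
proof -
  have "openin (top_of_set (snd c ` fst c)) (snd c ` (W \<inter> fst c))"
    using homeomorphism_imp_open_map[OF chart_homeomorphism[OF c]] W by (metis inf_commute openin_open_Int)
  moreover have "open (snd c ` fst c)"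
    using atlas c unfolding smooth_atlas_def by blast
  ultimately show ?thesis
    by (rule openin_open_trans)
qed

lemma chart_inv: "c \<in> A \<Longrightarrow> x \<in> fst c \<Longrightarrow> inv_into (fst c) (snd c) (snd c x) = x"
  using chart_homeomorphism homeomorphism_apply1 by blast

lemma in_chart_apply: "c \<in> A \<Longrightarrow> x \<in> fst c \<Longrightarrow> in_chart c f (snd c x) = f x"
  by (simp add: in_chart_def chart_inv)

lemma smooth_transition:
  "c \<in> A \<Longrightarrow> c' \<in> A \<Longrightarrow> smooth_on (snd c ` (fst c \<inter> fst c')) (in_chart c (snd c'))"
  using atlas unfolding smooth_atlas_def by blast

lemma smooth_fun_add:
  "open W \<Longrightarrow> smooth_fun A W f \<Longrightarrow> smooth_fun A W g \<Longrightarrow> smooth_fun A W (\<lambda>x. f x + g x)"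
  unfolding smooth_fun_def in_chart_def by (auto intro!: smooth_on_add open_chart_image)

lemma smooth_fun_mult:
  fixes f g :: "'m \<Rightarrow> 'b::real_normed_algebra"
  shows "open W \<Longrightarrow> smooth_fun A W f \<Longrightarrow> smooth_fun A W g \<Longrightarrow> smooth_fun A W (\<lambda>x. f x * g x)"
  unfolding smooth_fun_def in_chart_def by (auto intro!: smooth_on_mult open_chart_image)

text \<open>Any other chart reads \<open>f\<close> through a smooth transition map, so composition
  carries smoothness over.\<close>

lemma smooth_fun_single_chart:
  fixes f :: "'m \<Rightarrow> 'b::real_normed_field"
  assumes c: "c \<in> A" and W: "open W" "W \<subseteq> fst c" and f: "smooth_on (snd c ` W) (in_chart c f)"
  shows "smooth_fun A W f"
  unfolding smooth_fun_def
proof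
  fix c' assume c': "c' \<in> A"
  let ?S = "snd c' ` (W \<inter> fst c')"
  have "smooth_on ?S (in_chart c' (snd c))"
    using smooth_transition[OF c' c] by (rule smooth_on_mono) (use W in auto)
  moreover have "in_chart c' (snd c) ` ?S \<subseteq> snd c ` W"
    by (auto simp: in_chart_apply c')
  ultimately have "smooth_on ?S (\<lambda>y. in_chart c f (in_chart c' (snd c) y))"
    using f by (intro smooth_on_compose[OF open_chart_image[OF c' W(1)]])
  then show "smooth_on ?S (in_chart c' f)"
    by (rule smooth_on_cong[OF open_chart_image[OF c' W(1)], rotated])
      (use W in \<open>auto simp: in_chart_apply c c'\<close>)
qed

text \<open>The two coordinate representations of \<open>f\<close> differ by the transition map,
  whose derivative is \<open>jac\<close>; the chain rule becomes the transformation law of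
  covectors.\<close>

lemma d0_chain:
  assumes W: "open W" and f: "smooth_fun A W f" and c: "c \<in> A" "c' \<in> A"
    and x: "x \<in> W" "x \<in> fst c" "x \<in> fst c'"
  shows "d0 f c x u = d0 f c' x (jac c c' x u)"
proof -
  let ?S = "snd c ` (W \<inter> fst c' \<inter> fst c)"
  have S: "open ?S" "snd c x \<in> ?S"
    using open_chart_image[OF c(1), of "W \<inter> fst c'"] W open_chart[OF c(2)] x by auto
  have 1: "(in_chart c (snd c') has_derivative jac c c' x) (at (snd c x))"
    unfolding jac_def by (rule smooth_on_has_derivative[OF smooth_transition[OF c]]) (use x in auto)
  have 2: "(in_chart c' f has_derivative d0 f c' x) (at (in_chart c (snd c') (snd c x)))"
    unfolding d0_def in_chart_apply[OF c(1) x(2)]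
    by (rule smooth_on_has_derivative[of "snd c' ` (W \<inter> fst c')"])
      (use f x c in \<open>auto simp: smooth_fun_def\<close>)
  have "((\<lambda>y. in_chart c' f (in_chart c (snd c') y)) has_derivative (\<lambda>u. d0 f c' x (jac c c' x u))) (at (snd c x))"
    using has_derivative_compose[OF 1 2] .
  then have "(in_chart c f has_derivative (\<lambda>u. d0 f c' x (jac c c' x u))) (at (snd c x))"
    by (rule has_derivative_transform_within_open[OF _ S]) (auto simp: in_chart_apply c)
  then have "frechet_derivative (in_chart c f) (at (snd c x)) = (\<lambda>u. d0 f c' x (jac c c' x u))"
    by (rule frechet_derivative_at[symmetric])
  then show ?thesis
    by (subst d0_def) (rule fun_cong)
qed

section \<open>Differentials of functions and coordinate one-forms\<close>

lemma one_form_d0: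
  assumes W: "open W" and f: "smooth_fun A W f"
  shows "one_form A W (d0 f)"
  unfolding one_form_def
proof (intro conjI ballI allI)
  fix c x assume "c \<in> A" "x \<in> W \<inter> fst c"
  then have "in_chart c f differentiable (at (snd c x))"
    using f smooth_on_differentiable unfolding smooth_fun_def by blast
  then show "linear (d0 f c x)"
    unfolding d0_def by (rule linear_frechet_derivative)
next
  fix c c' x u assume "c \<in> A" "c' \<in> A" "x \<in> W \<inter> fst c \<inter> fst c'"
  then show "d0 f c x u = d0 f c' x (jac c c' x u)"
    by (intro d0_chain[OF W f]) auto
next
  fix c u assume c: "c \<in> A"
  have "smooth_on (snd c ` (W \<inter> fst c)) (\<lambda>y. frechet_derivative (in_chart c f) (at y) u)"
    using f c by (intro smooth_on_frechet_derivative) (auto simp: smooth_fun_def)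
  then show "smooth_on (snd c ` (W \<inter> fst c)) (in_chart c (\<lambda>x. d0 f c x u))"
    by (rule smooth_on_cong[OF open_chart_image[OF c W], rotated]) (auto simp: in_chart_apply c d0_def)
qed

lemma smooth_fun_chart_coord:
  assumes "c \<in> A" shows "smooth_fun A (fst c) (chart_coord c i)"
  unfolding smooth_fun_def
proof
  fix c' assume c': "c' \<in> A"
  have L: "bounded_linear (\<lambda>v :: real^'n. complex_of_real (v $ i))"
    by (rule bounded_linear_compose[OF bounded_linear_of_real bounded_linear_vec_nth])
  have "open (snd c' ` (fst c \<inter> fst c'))"
    using open_chart_image[OF c' open_chart[OF assms]] .
  from smooth_on_bounded_linear[OF this L] smooth_transition[OF c' assms]
  show "smooth_on (snd c' ` (fst c \<inter> fst c')) (in_chart c' (chart_coord c i))"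
    unfolding in_chart_def chart_coord_def by (simp add: Int_commute)
qed

text \<open>In the chart \<open>c'\<close>, coordinate \<open>i\<close> of \<open>c\<close> is a
  component of the transition map, so dx_i is a row of the Jacobian. This makes the sum of dx_i
  \<otimes> \<omega>(\<partial>_i) agree with \<omega> in every chart.\<close>

lemma d0_chart_coord:
  assumes c: "c \<in> A" "c' \<in> A" and x: "x \<in> fst c" "x \<in> fst c'"
  shows "d0 (chart_coord c i) c' x u = of_real (jac c' c x u $ i)"
proof -
  have L: "bounded_linear (\<lambda>v :: real^'n. complex_of_real (v $ i))"
    by (rule bounded_linear_compose[OF bounded_linear_of_real bounded_linear_vec_nth])
  have "(in_chart c' (snd c) has_derivative jac c' c x) (at (snd c' x))"
    unfolding jac_def by (rule smooth_on_has_derivative[OF smooth_transition[OF c(2,1)]]) (use x in auto)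
  from frechet_derivative_at[OF bounded_linear.has_derivative[OF L this], symmetric]
  show ?thesis
    unfolding d0_def in_chart_def chart_coord_def by simp
qed

lemma one_form_mono: "one_form A W \<beta> \<Longrightarrow> W' \<subseteq> W \<Longrightarrow> one_form A W' \<beta>"
  unfolding one_form_def by (blast intro: smooth_on_mono)

lemma real_one_form_d0_chart_coord:
  assumes "c \<in> A" "W \<subseteq> fst c" shows "real_one_form A W (d0 (chart_coord c i))"
  using one_form_mono[OF one_form_d0[OF open_chart smooth_fun_chart_coord]] assms
  unfolding real_one_form_def by (auto simp: d0_chart_coord)

lemma smooth_fun_one_form:
  assumes W: "open W" and \<beta>: "one_form A W \<beta>" and c: "c \<in> A"
  shows "smooth_fun A (W \<inter> fst c) (\<lambda>x. \<beta> c x u)"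
  using \<beta> c W open_chart[OF c] by (intro smooth_fun_single_chart[OF c]) (auto simp: one_form_def)

end

text \<open>Tensor decompositions are indexed by numbers below \<open>m\<close>, coordinate
  directions by the type \<open>'n\<close>; the bijection translates between them.\<close>

lemma ex_enum_finite:
  obtains h :: "nat \<Rightarrow> 'n::finite" where "bij_betw h {..<CARD('n)} UNIV"
  using ex_bij_betw_nat_finite[of "UNIV :: 'n set"] by (auto simp: atLeast0LessThan)


section \<open>Hermitian bundles\<close>

locale hermitian_vector_bundle = smooth_manifold A
  for A :: "('m::{t2_space, second_countable_topology}, 'n::finite) chart set" +
  fixes B :: "('m, 'v::ab_group_add) vbundle"
  assumes hermitian: "hermitian_bundle A B"
begin

section \<open>Fibres and local frames\<close>

lemma vector_space_scl: "vector_space (scl B)"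
  using hermitian unfolding hermitian_bundle_def vector_bundle_def by blast

sublocale V: vector_space "scl B"
  by (rule vector_space_scl)

lemma subspace_fibre: "V.subspace (fibre B x)"
  using hermitian unfolding hermitian_bundle_def vector_bundle_def by simp

lemmas fibre_add = V.subspace_add[OF subspace_fibre]
lemmas fibre_scl = V.subspace_scale[OF subspace_fibre]
lemmas fibre_diff = V.subspace_diff[OF subspace_fibre]
lemmas fibre_zero = V.subspace_0[OF subspace_fibre]
lemmas fibre_sum = V.subspace_sum[OF subspace_fibre]

lemma frame_cover: obtains U e where "(U, e) \<in> frames B" "x \<in> U"
proof -
  have "(\<Union>(U, e)\<in>frames B. U) = UNIV"
    using hermitian unfolding hermitian_bundle_def vector_bundle_def by (elim conjE)
  then show ?thesis using that by blast
qed

lemma frame_bundle: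
  assumes "(U, e) \<in> frames B"
  shows "open U \<and>
    (\<forall>x\<in>U. inj_on (\<lambda>a. e a x) {..<brank B} \<and>
       \<not> V.dependent ((\<lambda>a. e a x) ` {..<brank B}) \<and>
       V.span ((\<lambda>a. e a x) ` {..<brank B}) = fibre B x) \<and>
    (\<forall>a<brank B. bsection A B U (e a))"
proof -
  have "\<forall>(U, e)\<in>frames B. open U \<and>
        (\<forall>x\<in>U. inj_on (\<lambda>a. e a x) {..<brank B} \<and>
           \<not> V.dependent ((\<lambda>a. e a x) ` {..<brank B}) \<and>
           V.span ((\<lambda>a. e a x) ` {..<brank B}) = fibre B x) \<and>
        (\<forall>a<brank B. bsection A B U (e a))"
    using hermitian unfolding hermitian_bundle_def vector_bundle_def by (elim conjE)
  from bspec[OF this assms, unfolded prod.case] show ?thesis .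
qed

lemma frame_open: "(U, e) \<in> frames B \<Longrightarrow> open U"
  and frame_inj: "(U, e) \<in> frames B \<Longrightarrow> x \<in> U \<Longrightarrow> inj_on (\<lambda>a. e a x) {..<brank B}"
  and frame_span:
    "(U, e) \<in> frames B \<Longrightarrow> x \<in> U \<Longrightarrow> V.span ((\<lambda>a. e a x) ` {..<brank B}) = fibre B x"
  and bsection_frame: "(U, e) \<in> frames B \<Longrightarrow> a < brank B \<Longrightarrow> bsection A B U (e a)"
  using frame_bundle[of U e] by simp_all

lemma bsection_fibre: "bsection A B W \<sigma> \<Longrightarrow> x \<in> W \<Longrightarrow> \<sigma> x \<in> fibre B x"
  unfolding bsection_def by blast

lemma frame_fibre: "(U, e) \<in> frames B \<Longrightarrow> a < brank B \<Longrightarrow> x \<in> U \<Longrightarrow> e a x \<in> fibre B x"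
  using bsection_frame bsection_fibre by blast

lemma frame_expansion:
  assumes "(U, e) \<in> frames B" "x \<in> U" "v \<in> fibre B x"
  obtains k where "v = (\<Sum>a<brank B. scl B (k a) (e a x))"
proof -
  note inj = frame_inj[OF assms(1,2)]
  from assms(3) frame_span[OF assms(1,2)] have "v \<in> V.span ((\<lambda>a. e a x) ` {..<brank B})" by blast
  then obtain l where "v = (\<Sum>w\<in>(\<lambda>a. e a x) ` {..<brank B}. scl B (l w) w)"
    by (auto simp: V.span_finite)
  also have "\<dots> = (\<Sum>a<brank B. scl B (l (e a x)) (e a x))"
    by (simp add: sum.reindex[OF inj])
  finally show ?thesis by (rule that)
qed

section \<open>The Hermitian form on a single fibre\<close>

context
  fixes x :: 'm
begin

lemma herm_axioms:
  assumes "v \<in> fibre B x" "w \<in> fibre B x"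
  shows "(\<forall>z\<in>fibre B x. herm B x (v + w) z = herm B x v z + herm B x w z) \<and>
    (\<forall>k. herm B x (scl B k v) w = k * herm B x v w) \<and>
    herm B x w v = cnj (herm B x v w) \<and>
    (v \<noteq> 0 \<longrightarrow> Re (herm B x v v) > 0)"
  using conjunct1[OF conjunct2[OF hermitian[unfolded hermitian_bundle_def], unfolded hermitian_metric_def]]
    assms by blast

lemma herm_add_left:
  "v \<in> fibre B x \<Longrightarrow> w \<in> fibre B x \<Longrightarrow> z \<in> fibre B x \<Longrightarrow>
    herm B x (v + w) z = herm B x v z + herm B x w z"
  using herm_axioms[of v w] by simp

lemma herm_scl_left:
  "v \<in> fibre B x \<Longrightarrow> w \<in> fibre B x \<Longrightarrow> herm B x (scl B k v) w = k * herm B x v w"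
  using herm_axioms[of v w] by simp

lemma herm_cnj: "v \<in> fibre B x \<Longrightarrow> w \<in> fibre B x \<Longrightarrow> herm B x w v = cnj (herm B x v w)"
  using herm_axioms[of v w] by simp

lemma herm_pos: "v \<in> fibre B x \<Longrightarrow> v \<noteq> 0 \<Longrightarrow> Re (herm B x v v) > 0"
  using herm_axioms[of v v] by simp

lemma herm_zero_left: "w \<in> fibre B x \<Longrightarrow> herm B x 0 w = 0"
  using herm_scl_left[of 0 w 0] fibre_zero by simp

lemma herm_diff_left:
  assumes "v \<in> fibre B x" "w \<in> fibre B x" "z \<in> fibre B x"
  shows "herm B x (v - w) z = herm B x v z - herm B x w z"
  using herm_add_left[of "v - w" w z] assms fibre_diff by simp

lemma herm_sum_left:
  "(\<And>i. i \<in> I \<Longrightarrow> f i \<in> fibre B x) \<Longrightarrow> z \<in> fibre B x \<Longrightarrow>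
    herm B x (\<Sum>i\<in>I. f i) z = (\<Sum>i\<in>I. herm B x (f i) z)"
  by (induction I rule: infinite_finite_induct)
    (auto simp: herm_zero_left herm_add_left fibre_sum)

lemma herm_sum_scl_left:
  assumes "\<And>i. i \<in> I \<Longrightarrow> f i \<in> fibre B x" "z \<in> fibre B x"
  shows "herm B x (\<Sum>i\<in>I. scl B (k i) (f i)) z = (\<Sum>i\<in>I. k i * herm B x (f i) z)"
  using assms by (simp add: herm_sum_left fibre_scl herm_scl_left)

lemma herm_sum_scl_right:
  assumes "\<And>i. i \<in> I \<Longrightarrow> f i \<in> fibre B x" "z \<in> fibre B x"
  shows "herm B x z (\<Sum>i\<in>I. scl B (k i) (f i)) = (\<Sum>i\<in>I. cnj (k i) * herm B x z (f i))"
proof -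
  have "herm B x z (\<Sum>i\<in>I. scl B (k i) (f i)) = cnj (herm B x (\<Sum>i\<in>I. scl B (k i) (f i)) z)"
    by (rule herm_cnj) (auto intro: assms fibre_sum fibre_scl)
  also have "\<dots> = (\<Sum>i\<in>I. cnj (k i) * herm B x z (f i))"
    using assms herm_cnj[of "f _" z] by (simp add: herm_sum_scl_left)
  finally show ?thesis .
qed

text \<open>Expanding the second argument of \<open>herm B x v v\<close> in the frame leaves only
  vanishing pairings, against positivity. As \<open>'v\<close> carries no topology, this test is
  what reduces equations between fibre vectors to equations between complex numbers, where limits
  make sense.\<close>

lemma herm_nondegenerate:
  assumes fr: "(U, e) \<in> frames B" "x \<in> U" and v: "v \<in> fibre B x"
    and 0: "\<And>b. b < brank B \<Longrightarrow> herm B x v (e b x) = 0"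
  shows "v = 0"
proof (rule ccontr)
  assume "v \<noteq> 0"
  obtain k where k: "v = (\<Sum>a<brank B. scl B (k a) (e a x))"
    using frame_expansion[OF fr v] .
  have "herm B x v v = (\<Sum>a<brank B. cnj (k a) * herm B x v (e a x))"
    by (subst (2) k, rule herm_sum_scl_right) (use fr v in \<open>auto intro: frame_fibre\<close>)
  then show False
    using herm_pos[OF v \<open>v \<noteq> 0\<close>] 0 by simp
qed

text \<open>An orthogonal basis by Gram--Schmidt; it turns weak limits into limits of products.\<close>

lemma orthogonal_expansion_span:
  assumes "finite S" "S \<subseteq> fibre B x"
  shows "\<exists>T. finite T \<and> T \<subseteq> V.span S \<and>
    (\<forall>w\<in>V.span S. w = (\<Sum>d\<in>T. scl B (herm B x w d / herm B x d d) d))"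
  using assms
proof (induction S rule: finite_induct)
  case empty
  show ?case by (intro exI[of _ "{}"]) auto
next
  case (insert s S)
  then obtain T where T: "finite T" "T \<subseteq> V.span S"
    and expand: "\<And>w. w \<in> V.span S \<Longrightarrow> w = (\<Sum>d\<in>T. scl B (herm B x w d / herm B x d d) d)" by auto
  have s: "s \<in> fibre B x" using insert by auto
  have spanS: "v \<in> fibre B x" if "v \<in> V.span S" for v
    using insert.prems V.span_minimal[OF _ subspace_fibre] that by auto
  have TB: "d \<in> fibre B x" if "d \<in> T" for d
    using that T spanS by auto
  \<comment> \<open>\<open>p\<close> is the orthogonal projection of \<open>s\<close> to the span of
    \<open>S\<close>. The remainder \<open>r\<close> below extends \<open>T\<close> unless it
    vanishes.\<close>
  define p where "p = (\<Sum>d\<in>T. scl B (herm B x s d / herm B x d d) d)"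
  have pS: "p \<in> V.span S" unfolding p_def using T by (intro V.span_sum V.span_scale) auto
  define r where "r = s - p"
  have r: "r \<in> fibre B x" unfolding r_def using s spanS[OF pS] by (rule fibre_diff)
  have orth: "herm B x r w = 0" if w: "w \<in> V.span S" for w
  proof -
    have "herm B x p w = (\<Sum>d\<in>T. herm B x s d / herm B x d d * herm B x d w)"
      unfolding p_def by (rule herm_sum_scl_left) (auto intro: TB spanS w)
    \<comment> \<open>Hermitian symmetry makes \<open>herm B x d d\<close> real and exchanges the
      arguments, so the coefficients of the projection of \<open>s\<close> turn into those of the
      expansion of \<open>w\<close>.\<close>
    also have "\<dots> = (\<Sum>d\<in>T. cnj (herm B x w d / herm B x d d) * herm B x s d)"
    proof (rule sum.cong)
      fix d assume "d \<in> T"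
      then show "herm B x s d / herm B x d d * herm B x d w = cnj (herm B x w d / herm B x d d) * herm B x s d"
        using herm_cnj[OF TB TB, of d d] herm_cnj[OF spanS[OF w] TB, of d] by simp
    qed simp
    also have "\<dots> = herm B x s (\<Sum>d\<in>T. scl B (herm B x w d / herm B x d d) d)"
      by (rule herm_sum_scl_right[symmetric]) (auto intro: TB s)
    also have "\<dots> = herm B x s w"
      using expand[OF w] by simp
    finally show ?thesis
      unfolding r_def using herm_diff_left[OF s spanS[OF pS] spanS[OF w]] by simp
  qed
  show ?case
  proof (cases "r = 0")
    case True
    then have "s \<in> V.span S" using pS by (simp add: r_def)
    then show ?thesis
      using T expand by (intro exI[of _ T]) (simp add: V.span_redundant)
  next
    case False
    then have N: "herm B x r r \<noteq> 0" using herm_pos[OF r] by auto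
    have "r \<notin> T" using orth T N by blast
    have rS: "r \<in> V.span (insert s S)"
      unfolding r_def using subsetD[OF V.span_mono[OF subset_insertI] pS] by (intro V.span_diff V.span_base[of s]) auto
    have "w = (\<Sum>d\<in>insert r T. scl B (herm B x w d / herm B x d d) d)" if w: "w \<in> V.span (insert s S)" for w
    proof -
      \<comment> \<open>The coefficient of \<open>s\<close> in \<open>w\<close> also serves for
        \<open>r\<close>, because \<open>s\<close> and \<open>r\<close> differ by \<open>p\<close>
        in the span of \<open>S\<close>. Hence \<open>q\<close> lies in that span and is orthogonal
        to \<open>r\<close>.\<close>
      obtain k where k: "w - scl B k s \<in> V.span S"
        using w V.span_breakdown_eq by blast
      define q where "q = w - scl B k r"
      have "q = (w - scl B k s) + scl B k p"
        unfolding q_def r_def by (simp add: V.scale_right_diff_distrib)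
      then have q: "q \<in> V.span S"
        using k pS by (auto intro: V.span_add V.span_scale)
      have wq: "w = q + scl B k r" by (simp add: q_def)
      have "herm B x w d = herm B x q d" if "d \<in> T" for d
        unfolding wq using herm_add_left[OF spanS[OF q] fibre_scl[OF r] TB[OF that], of k]
          herm_scl_left[OF r TB[OF that], of k] orth[of d] T that by auto
      then have "(\<Sum>d\<in>T. scl B (herm B x w d / herm B x d d) d) = q"
        using expand[OF q] by simp
      moreover have "herm B x q r = 0"
        using herm_cnj[OF r spanS[OF q]] orth[OF q] by simp
      then have "herm B x w r = k * herm B x r r"
        unfolding wq using herm_add_left[OF spanS[OF q] fibre_scl[OF r] r, of k]
          herm_scl_left[OF r r, of k] by simp
      ultimately show ?thesis
        using \<open>r \<notin> T\<close> T(1) N by (simp add: q_def)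
    qed
    then show ?thesis
      using T rS V.span_mono[of S "insert s S"] by (intro exI[of _ "insert r T"]) auto
  qed
qed

lemma orthogonal_expansion:
  obtains T where "finite T" "T \<subseteq> fibre B x"
    "\<And>w. w \<in> fibre B x \<Longrightarrow> w = (\<Sum>d\<in>T. scl B (herm B x w d / herm B x d d) d)"
proof -
  obtain U e where fr: "(U, e) \<in> frames B" "x \<in> U" by (rule frame_cover)
  then have "V.span ((\<lambda>a. e a x) ` {..<brank B}) = fibre B x"
    by (rule frame_span)
  moreover have "(\<lambda>a. e a x) ` {..<brank B} \<subseteq> fibre B x"
    using frame_fibre[OF fr(1) _ fr(2)] by auto
  ultimately show ?thesis
    using orthogonal_expansion_span[of "(\<lambda>a. e a x) ` {..<brank B}"] that by auto
qed

end

end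


section \<open>Connections on coordinate fields\<close>

text \<open>Replaces the definite description in \<open>end_conn1\<close> by an expression in which
  linearity in \<open>E\<close> is visible for a connection \<open>D\<close>, so that scaling and
  limits can be computed.\<close>

definition end_deriv ::
  "('m, 'n, 'v::ab_group_add) sheaf_op \<Rightarrow> ('m, 'n, 'v \<Rightarrow> 'v) form1 \<Rightarrow> ('m \<Rightarrow> 'v) \<Rightarrow>
   ('m, 'n) chart \<Rightarrow> 'm \<Rightarrow> real ^ 'n \<Rightarrow> real ^ 'n \<Rightarrow> 'v"
where
  "end_deriv D E \<sigma> c x u v =
     (D (\<lambda>z. E c z v (\<sigma> z)) c x u - E c x v (D \<sigma> c x u)) -
     (D (\<lambda>z. E c z u (\<sigma> z)) c x v - E c x u (D \<sigma> c x v))"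

text \<open>The corresponding replacement for \<open>wedge_square\<close>. No factor 1/2 appears, in
  accordance with the convention (\<eta> \<and> \<theta>)(u, v) = \<eta>(u) \<theta>(v) - \<eta>(v)
  \<theta>(u).\<close>

definition form_bracket ::
  "('m, 'n, 'v::ab_group_add \<Rightarrow> 'v) form1 \<Rightarrow>
   ('m, 'n) chart \<Rightarrow> 'm \<Rightarrow> real ^ 'n \<Rightarrow> real ^ 'n \<Rightarrow> 'v \<Rightarrow> 'v"
where
  "form_bracket E c x u v w = E c x u (E c x v w) - E c x v (E c x u w)"

context hermitian_vector_bundle
begin

section \<open>Smooth sections as a module over the smooth functions\<close>

lemma bsection_coeffs:
  assumes "bsection A B W \<sigma>" "(U, e) \<in> frames B"
  obtains f where "\<And>a. a < brank B \<Longrightarrow> smooth_fun A (W \<inter> U) (f a)"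
    "\<And>x. x \<in> W \<inter> U \<Longrightarrow> \<sigma> x = (\<Sum>a<brank B. scl B (f a x) (e a x))"
proof -
  have "\<forall>(U, e)\<in>frames B. \<exists>f. (\<forall>a<brank B. smooth_fun A (W \<inter> U) (f a)) \<and>
        (\<forall>x\<in>W \<inter> U. \<sigma> x = (\<Sum>a<brank B. scl B (f a x) (e a x)))"
    using assms(1) unfolding bsection_def by (elim conjE)
  from bspec[OF this assms(2), unfolded prod.case] show ?thesis
    using that by blast
qed

lemma bsectionI:
  assumes "\<And>x. x \<in> W \<Longrightarrow> \<sigma> x \<in> fibre B x"
    and "\<And>U e. (U, e) \<in> frames B \<Longrightarrow> \<exists>f. (\<forall>a<brank B. smooth_fun A (W \<inter> U) (f a)) \<and>
        (\<forall>x\<in>W \<inter> U. \<sigma> x = (\<Sum>a<brank B. scl B (f a x) (e a x)))"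
  shows "bsection A B W \<sigma>"
  unfolding bsection_def using assms by blast

lemma bsection_mono:
  assumes "bsection A B W \<sigma>" "W' \<subseteq> W"
  shows "bsection A B W' \<sigma>"
proof (rule bsectionI)
  fix U e assume "(U, e) \<in> frames B"
  then obtain f where "\<And>a. a < brank B \<Longrightarrow> smooth_fun A (W \<inter> U) (f a)"
    "\<And>x. x \<in> W \<inter> U \<Longrightarrow> \<sigma> x = (\<Sum>a<brank B. scl B (f a x) (e a x))"
    using bsection_coeffs[OF assms(1)] by metis
  then show "\<exists>f. (\<forall>a<brank B. smooth_fun A (W' \<inter> U) (f a)) \<and>
        (\<forall>x\<in>W' \<inter> U. \<sigma> x = (\<Sum>a<brank B. scl B (f a x) (e a x)))"
    using assms(2) smooth_fun_mono[of A "W \<inter> U" _ "W' \<inter> U"] by (intro exI[of _ f]) blast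
qed (use assms bsection_fibre in blast)

lemma bsection_cong:
  assumes "bsection A B W \<sigma>" "\<And>x. x \<in> W \<Longrightarrow> \<sigma> x = \<tau> x"
  shows "bsection A B W \<tau>"
proof (rule bsectionI)
  fix U e assume "(U, e) \<in> frames B"
  then obtain f where "\<And>a. a < brank B \<Longrightarrow> smooth_fun A (W \<inter> U) (f a)"
    "\<And>x. x \<in> W \<inter> U \<Longrightarrow> \<sigma> x = (\<Sum>a<brank B. scl B (f a x) (e a x))"
    using bsection_coeffs[OF assms(1)] by metis
  then show "\<exists>f. (\<forall>a<brank B. smooth_fun A (W \<inter> U) (f a)) \<and>
        (\<forall>x\<in>W \<inter> U. \<tau> x = (\<Sum>a<brank B. scl B (f a x) (e a x)))"
    using assms(2) by (intro exI[of _ f]) auto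
next
  fix x assume "x \<in> W"
  then show "\<tau> x \<in> fibre B x"
    using bsection_fibre[OF assms(1)] assms(2) by metis
qed

lemma bsection_add:
  assumes W: "open W" and "bsection A B W \<sigma>" "bsection A B W \<tau>"
  shows "bsection A B W (\<lambda>x. \<sigma> x + \<tau> x)"
proof (rule bsectionI)
  fix U e assume fr: "(U, e) \<in> frames B"
  obtain f where f: "\<And>a. a < brank B \<Longrightarrow> smooth_fun A (W \<inter> U) (f a)"
    "\<And>x. x \<in> W \<inter> U \<Longrightarrow> \<sigma> x = (\<Sum>a<brank B. scl B (f a x) (e a x))"
    using bsection_coeffs[OF assms(2) fr] by metis
  obtain g where g: "\<And>a. a < brank B \<Longrightarrow> smooth_fun A (W \<inter> U) (g a)"
    "\<And>x. x \<in> W \<inter> U \<Longrightarrow> \<tau> x = (\<Sum>a<brank B. scl B (g a x) (e a x))"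
    using bsection_coeffs[OF assms(3) fr] by metis
  show "\<exists>f. (\<forall>a<brank B. smooth_fun A (W \<inter> U) (f a)) \<and>
        (\<forall>x\<in>W \<inter> U. \<sigma> x + \<tau> x = (\<Sum>a<brank B. scl B (f a x) (e a x)))"
    using f g W frame_open[OF fr]
    by (intro exI[of _ "\<lambda>a x. f a x + g a x"])
      (auto intro!: smooth_fun_add simp: V.scale_left_distrib sum.distrib)
qed (use assms in \<open>auto intro: fibre_add bsection_fibre\<close>)

lemma bsection_scl:
  assumes W: "open W" and "smooth_fun A W k" "bsection A B W \<sigma>"
  shows "bsection A B W (\<lambda>x. scl B (k x) (\<sigma> x))"
proof (rule bsectionI)
  fix U e assume fr: "(U, e) \<in> frames B"
  obtain f where f: "\<And>a. a < brank B \<Longrightarrow> smooth_fun A (W \<inter> U) (f a)"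
    "\<And>x. x \<in> W \<inter> U \<Longrightarrow> \<sigma> x = (\<Sum>a<brank B. scl B (f a x) (e a x))"
    using bsection_coeffs[OF assms(3) fr] by metis
  show "\<exists>f. (\<forall>a<brank B. smooth_fun A (W \<inter> U) (f a)) \<and>
        (\<forall>x\<in>W \<inter> U. scl B (k x) (\<sigma> x) = (\<Sum>a<brank B. scl B (f a x) (e a x)))"
    using f W frame_open[OF fr] smooth_fun_mono[OF assms(2), of "W \<inter> U"]
    by (intro exI[of _ "\<lambda>a x. k x * f a x"])
      (auto intro!: smooth_fun_mult simp: V.scale_sum_right)
qed (use assms in \<open>auto intro: fibre_scl bsection_fibre\<close>)

lemma bsection_scl_const:
  "open W \<Longrightarrow> bsection A B W \<sigma> \<Longrightarrow> bsection A B W (\<lambda>x. scl B k (\<sigma> x))"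
  using bsection_scl[OF _ smooth_fun_const] .

lemma bsection_diff:
  assumes "open W" "bsection A B W \<sigma>" "bsection A B W \<tau>"
  shows "bsection A B W (\<lambda>x. \<sigma> x - \<tau> x)"
  using bsection_add[OF assms(1,2) bsection_scl_const[OF assms(1,3), of "- 1"]] by simp

lemma bsection_zero: "bsection A B W (\<lambda>x. 0)"
  by (rule bsectionI) (auto intro!: exI[of _ "\<lambda>a x. 0"] smooth_fun_const fibre_zero)

lemma bsection_sum:
  "open W \<Longrightarrow> (\<And>i. i \<in> I \<Longrightarrow> bsection A B W (\<sigma> i)) \<Longrightarrow> bsection A B W (\<lambda>x. \<Sum>i\<in>I. \<sigma> i x)"
  by (induction I rule: infinite_finite_induct) (auto intro: bsection_zero bsection_add)

section \<open>Pointwise rules for a connection\<close>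

context
  fixes D :: "('m, 'n, 'v) sheaf_op"
  assumes D: "connection A B D"
begin

lemma connection_axioms:
  assumes "open W" "bsection A B W \<sigma>"
  shows "bundle_one_form A B W (D \<sigma>) \<and>
        (\<forall>\<tau>. bsection A B W \<tau> \<longrightarrow> (\<forall>x\<in>W. \<sigma> x = \<tau> x) \<longrightarrow>
           (\<forall>c\<in>A. \<forall>x\<in>W \<inter> fst c. \<forall>u. D \<sigma> c x u = D \<tau> c x u)) \<and>
        (\<forall>\<tau>. bsection A B W \<tau> \<longrightarrow>
           (\<forall>c\<in>A. \<forall>x\<in>W \<inter> fst c. \<forall>u. D (\<lambda>z. \<sigma> z + \<tau> z) c x u = D \<sigma> c x u + D \<tau> c x u)) \<and>
        (\<forall>f :: 'm \<Rightarrow> complex. smooth_fun A W f \<longrightarrow>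
           (\<forall>c\<in>A. \<forall>x\<in>W \<inter> fst c. \<forall>u.
              D (\<lambda>z. scl B (f z) (\<sigma> z)) c x u =
              scl B (d0 f c x u) (\<sigma> x) + scl B (f x) (D \<sigma> c x u)))"
  by (rule D[unfolded connection_def, THEN spec, THEN spec, THEN mp, THEN mp, OF assms])

context
  fixes W c x
  assumes W: "open W" and c: "c \<in> A" and x: "x \<in> W" "x \<in> fst c"
begin

text \<open>Locality: a tensor decomposition reproduces a form only over an open set, and this rule
  allows its substitution under \<open>D\<close> all the same.\<close>

lemma connection_cong:
  assumes \<sigma>: "bsection A B W \<sigma>" and eq: "\<And>z. z \<in> W \<Longrightarrow> \<sigma> z = \<tau> z"
  shows "D \<sigma> c x u = D \<tau> c x u"
proof -
  have "bsection A B W \<tau>" using bsection_cong[OF \<sigma> eq] .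
  with conjunct1[OF conjunct2[OF connection_axioms[OF W \<sigma>]]] show ?thesis
    using eq c x by blast
qed

lemma connection_add:
  assumes "bsection A B W \<sigma>" "bsection A B W \<tau>"
  shows "D (\<lambda>z. \<sigma> z + \<tau> z) c x u = D \<sigma> c x u + D \<tau> c x u"
  using conjunct1[OF conjunct2[OF conjunct2[OF connection_axioms[OF W assms(1)]]]] assms(2) c x by blast

lemma connection_leibniz:
  assumes "smooth_fun A W f" "bsection A B W \<sigma>"
  shows "D (\<lambda>z. scl B (f z) (\<sigma> z)) c x u = scl B (d0 f c x u) (\<sigma> x) + scl B (f x) (D \<sigma> c x u)"
  using conjunct2[OF conjunct2[OF conjunct2[OF connection_axioms[OF W assms(2)]]]] assms(1) c x by blast

lemma connection_scl:
  assumes "bsection A B W \<sigma>"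
  shows "D (\<lambda>z. scl B k (\<sigma> z)) c x u = scl B k (D \<sigma> c x u)"
  using connection_leibniz[OF smooth_fun_const assms] by (simp add: d0_const)

lemma connection_diff:
  assumes "bsection A B W \<sigma>" "bsection A B W \<tau>"
  shows "D (\<lambda>z. \<sigma> z - \<tau> z) c x u = D \<sigma> c x u - D \<tau> c x u"
  using connection_add[OF assms(1) bsection_scl_const[OF W assms(2)], of "- 1"]
    connection_scl[OF assms(2), of "- 1"] by simp

lemma connection_sum:
  assumes "\<And>i. i \<in> I \<Longrightarrow> bsection A B W (\<sigma> i)"
  shows "D (\<lambda>z. \<Sum>i\<in>I. \<sigma> i z) c x u = (\<Sum>i\<in>I. D (\<sigma> i) c x u)"
proof -
  have 0: "D (\<lambda>z. 0) c x u = 0"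
    using connection_scl[OF bsection_zero, of 0] by simp
  show ?thesis
    using assms
  proof (induction I rule: infinite_finite_induct)
    case (insert i I)
    then show ?case
      using connection_add[of "\<sigma> i" "\<lambda>z. \<Sum>i\<in>I. \<sigma> i z"] by (simp add: bsection_sum W)
  qed (auto simp: 0)
qed

lemma connection_sum_leibniz:
  assumes "\<And>i. i \<in> I \<Longrightarrow> smooth_fun A W (f i)" "\<And>i. i \<in> I \<Longrightarrow> bsection A B W (\<sigma> i)"
  shows "D (\<lambda>z. \<Sum>i\<in>I. scl B (f i z) (\<sigma> i z)) c x u =
    (\<Sum>i\<in>I. scl B (d0 (f i) c x u) (\<sigma> i x) + scl B (f i x) (D (\<sigma> i) c x u))"
  using assms by (simp add: connection_sum bsection_scl W connection_leibniz)

lemma bsection_connection: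
  assumes "bsection A B W \<sigma>"
  shows "bsection A B (W \<inter> fst c) (\<lambda>x. D \<sigma> c x u)"
  using conjunct1[OF connection_axioms[OF W assms]] c unfolding bundle_one_form_def by blast

lemma connection_fibre: "bsection A B W \<sigma> \<Longrightarrow> D \<sigma> c x u \<in> fibre B x"
  using bsection_fibre[OF bsection_connection] x by simp

end

text \<open>Evaluating a decomposition of \<open>\<omega>\<close> on constant coordinate fields, for which the bracket
  term of Cartan's formula vanishes.\<close>

lemma section_tensor_rep_conn1:
  assumes rep: "section_tensor_rep A B W \<omega> m \<beta> \<sigma>" and c: "c \<in> A" and x: "x \<in> W" "x \<in> fst c"
  shows "(\<Sum>a<m. scl B (d1 (\<beta> a) c x u v) (\<sigma> a x) -
           (scl B (\<beta> a c x u) (D (\<sigma> a) c x v) - scl B (\<beta> a c x v) (D (\<sigma> a) c x u))) =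
    D (\<lambda>z. \<omega> c z v) c x u - D (\<lambda>z. \<omega> c z u) c x v"
proof -
  have W: "open W" and \<beta>: "\<And>a. a < m \<Longrightarrow> one_form A W (\<beta> a)"
    and \<sigma>: "\<And>a. a < m \<Longrightarrow> bsection A B W (\<sigma> a)"
    and \<omega>: "\<And>z u. z \<in> W \<inter> fst c \<Longrightarrow> \<omega> c z u = (\<Sum>a<m. scl B (\<beta> a c z u) (\<sigma> a z))"
    using rep c unfolding section_tensor_rep_def by auto
  have W': "open (W \<inter> fst c)" "x \<in> W \<inter> fst c"
    using W open_chart[OF c] x by auto
  have \<beta>': "smooth_fun A (W \<inter> fst c) (\<lambda>z. \<beta> a c z u)" if "a < m" for a u
    using smooth_fun_one_form[OF W \<beta>[OF that] c] .
  have \<sigma>': "bsection A B (W \<inter> fst c) (\<sigma> a)" if "a < m" for a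
    using bsection_mono[OF \<sigma>[OF that]] by auto
  \<comment> \<open>Stated for all \<open>u\<close> and \<open>v\<close>, so that the exchanged term
    is another instance. In the difference of the two, the derivatives of the coefficients combine
    to \<open>d1 (\<beta> a)\<close>.\<close>
  have "D (\<lambda>z. \<omega> c z v) c x u =
      (\<Sum>a<m. scl B (d0 (\<lambda>z. \<beta> a c z v) c x u) (\<sigma> a x) + scl B (\<beta> a c x v) (D (\<sigma> a) c x u))" for u v
  proof -
    have "D (\<lambda>z. \<Sum>a<m. scl B (\<beta> a c z v) (\<sigma> a z)) c x u = D (\<lambda>z. \<omega> c z v) c x u"
      by (rule connection_cong[OF W'(1) c W'(2) x(2)])
        (auto intro!: bsection_sum bsection_scl W' \<beta>' \<sigma>' simp: \<omega>)
    then show ?thesis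
      using connection_sum_leibniz[OF W'(1) c W'(2) x(2), of "{..<m}" "\<lambda>a z. \<beta> a c z v" \<sigma> u] \<beta>' \<sigma>' by simp
  qed
  then show ?thesis
    unfolding sum_subtractf[symmetric] d1_def
    by (simp only: sum_subtractf[symmetric]) (simp add: V.scale_left_diff_distrib algebra_simps)
qed

text \<open>The sum of dx_i \<otimes> \<omega>(\<partial>_i) shows that a decomposition exists near
  the point, and by the preceding evaluation all decompositions give the same value. So the definite
  description in \<open>conn1\<close> is legitimate.\<close>

lemma conn1_eq:
  assumes W: "open W" and \<omega>: "bundle_one_form A B W \<omega>" and c: "c \<in> A" and x: "x \<in> W" "x \<in> fst c"
  shows "conn1 A B D \<omega> c x u v = D (\<lambda>z. \<omega> c z v) c x u - D (\<lambda>z. \<omega> c z u) c x v"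
proof -
  obtain h :: "nat \<Rightarrow> 'n" where h: "bij_betw h {..<CARD('n)} UNIV" by (rule ex_enum_finite)
  note form = \<omega>[unfolded bundle_one_form_def]
  have trans: "\<omega> c' z u = \<omega> c z (jac c' c z u)" if "c' \<in> A" "z \<in> W \<inter> fst c" "z \<in> fst c'" for c' z u
    using conjunct1[OF conjunct2[OF form]] c that by blast
  have add: "\<omega> c z (u + v) = \<omega> c z u + \<omega> c z v"
    and scl: "\<omega> c z (k *\<^sub>R u) = scl B (of_real k) (\<omega> c z u)" if "z \<in> W \<inter> fst c" for z u v k
    using conjunct1[OF form] c that by blast+
  have exp: "\<omega> c z u = (\<Sum>i\<in>UNIV. scl B (of_real (u $ i)) (\<omega> c z (axis i 1)))" if z: "z \<in> W \<inter> fst c" for z u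
  proof -
    have "\<omega> c z (\<Sum>i\<in>I. u $ i *\<^sub>R axis i 1) = (\<Sum>i\<in>I. scl B (of_real (u $ i)) (\<omega> c z (axis i 1)))"
      if "finite I" for I
      using that
    proof induction
      case empty
      then show ?case using scl[OF z, of 0] by simp
    next
      case (insert i I)
      then show ?case using add[OF z] scl[OF z] by simp
    qed
    from this[of UNIV] show ?thesis by (simp add: basis_expansion flip: scalar_mult_eq_scaleR)
  qed
  have rep: "section_tensor_rep A B (W \<inter> fst c) \<omega> CARD('n) (\<lambda>a. d0 (chart_coord c (h a)))
      (\<lambda>a z. \<omega> c z (axis (h a) 1))"
    unfolding section_tensor_rep_def
  proof (intro conjI allI impI ballI)
    show "open (W \<inter> fst c)" using W open_chart[OF c] by auto
    show "one_form A (W \<inter> fst c) (d0 (chart_coord c (h a)))" for a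
      using real_one_form_d0_chart_coord[OF c, of "W \<inter> fst c"] unfolding real_one_form_def by auto
    show "bsection A B (W \<inter> fst c) (\<lambda>z. \<omega> c z (axis (h a) 1))" for a
      using conjunct2[OF conjunct2[OF form]] c by blast
    fix c' z u assume c': "c' \<in> A" and z: "z \<in> W \<inter> fst c \<inter> fst c'"
    have "\<omega> c' z u = (\<Sum>i\<in>UNIV. scl B (of_real (jac c' c z u $ i)) (\<omega> c z (axis i 1)))"
      unfolding trans[OF c' IntD1[OF z] IntD2[OF z]] by (rule exp[OF IntD1[OF z]])
    also have "\<dots> = (\<Sum>a<CARD('n). scl B (d0 (chart_coord c (h a)) c' z u) (\<omega> c z (axis (h a) 1)))"
      using z c c' by (subst sum.reindex_bij_betw[OF h, symmetric]) (simp add: d0_chart_coord)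
    finally show "\<omega> c' z u = (\<Sum>a<CARD('n). scl B (d0 (chart_coord c (h a)) c' z u) (\<omega> c z (axis (h a) 1)))" .
  qed
  show ?thesis
    unfolding conn1_def
  proof (rule the_equality, intro exI conjI)
    show "x \<in> W \<inter> fst c" using x by simp
    then show "D (\<lambda>z. \<omega> c z v) c x u - D (\<lambda>z. \<omega> c z u) c x v = (\<Sum>a<CARD('n).
        scl B (d1 (d0 (chart_coord c (h a))) c x u v) (\<omega> c x (axis (h a) 1)) -
        (scl B (d0 (chart_coord c (h a)) c x u) (D (\<lambda>z. \<omega> c z (axis (h a) 1)) c x v) -
         scl B (d0 (chart_coord c (h a)) c x v) (D (\<lambda>z. \<omega> c z (axis (h a) 1)) c x u)))"
      by (rule section_tensor_rep_conn1[OF rep c _ x(2), symmetric])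
  qed (use rep in \<open>auto simp only: section_tensor_rep_conn1[OF _ c _ x(2)]\<close>)
qed

end

section \<open>Antihermitian one-forms and their wedge square\<close>

lemma
  assumes h: "antiherm_section A B W h" and x: "x \<in> W"
  shows antiherm_section_fibre: "v \<in> fibre B x \<Longrightarrow> h x v \<in> fibre B x"
    and antiherm_section_add:
      "v \<in> fibre B x \<Longrightarrow> w \<in> fibre B x \<Longrightarrow> h x (v + w) = h x v + h x w"
    and antiherm_section_scl: "v \<in> fibre B x \<Longrightarrow> h x (scl B k v) = scl B k (h x v)"
  using conjunct1[OF h[unfolded antiherm_section_def]] x by blast+

lemma bsection_antiherm_section:
  "antiherm_section A B W h \<Longrightarrow> open V \<Longrightarrow> V \<subseteq> W \<Longrightarrow> bsection A B V \<sigma> \<Longrightarrow>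
    bsection A B V (\<lambda>x. h x (\<sigma> x))"
  unfolding antiherm_section_def by blast

lemma antiherm_section_sum_scl:
  assumes h: "antiherm_section A B W h" and x: "x \<in> W" and "\<And>i. i \<in> I \<Longrightarrow> f i \<in> fibre B x"
  shows "h x (\<Sum>i\<in>I. scl B (k i) (f i)) = (\<Sum>i\<in>I. scl B (k i) (h x (f i)))"
proof -
  have 0: "h x 0 = 0"
    using antiherm_section_scl[OF h x fibre_zero, of 0] by simp
  show ?thesis
    using assms(3)
  proof (induction I rule: infinite_finite_induct)
    case (insert i I)
    then have "h x (scl B (k i) (f i) + (\<Sum>i\<in>I. scl B (k i) (f i))) =
        h x (scl B (k i) (f i)) + h x (\<Sum>i\<in>I. scl B (k i) (f i))"
      by (intro antiherm_section_add[OF h x]) (auto intro: fibre_sum fibre_scl)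
    with insert show ?case
      by (simp add: antiherm_section_scl[OF h x])
  qed (auto simp: 0)
qed

lemma
  assumes E: "antiherm_one_form A B UNIV E" and c: "c \<in> A"
  shows antiherm_one_form_section: "antiherm_section A B (fst c) (\<lambda>x. E c x u)"
    and antiherm_one_form_chart: "c' \<in> A \<Longrightarrow> x \<in> fst c \<Longrightarrow> x \<in> fst c' \<Longrightarrow> w \<in> fibre B x \<Longrightarrow>
      E c x u w = E c' x (jac c c' x u) w"
    and antiherm_one_form_add: "x \<in> fst c \<Longrightarrow> w \<in> fibre B x \<Longrightarrow>
      E c x (u + v) w = E c x u w + E c x v w"
    and antiherm_one_form_scaleR: "x \<in> fst c \<Longrightarrow> w \<in> fibre B x \<Longrightarrow>
      E c x (k *\<^sub>R u) w = scl B (of_real k) (E c x u w)"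
  using E[unfolded antiherm_one_form_def Int_UNIV_left] c by blast+

text \<open>The decomposition is again the sum of dx_i \<otimes> E(\<partial>_i), over the whole
  chart domain. The dx_i are real, so the antihermitian endomorphisms E(\<partial>_i) are admissible
  second factors.\<close>

lemma antiherm_tensor_rep_exists:
  assumes E: "antiherm_one_form A B UNIV E" and c: "c \<in> A"
  obtains m \<eta> e where "antiherm_tensor_rep A B (fst c) E m \<eta> e"
proof -
  obtain h :: "nat \<Rightarrow> 'n" where h: "bij_betw h {..<CARD('n)} UNIV" by (rule ex_enum_finite)
  have exp: "E c z u w = (\<Sum>i\<in>UNIV. scl B (of_real (u $ i)) (E c z (axis i 1) w))"
    if z: "z \<in> fst c" and w: "w \<in> fibre B z" for z u w
  proof -
    have "E c z (\<Sum>i\<in>I. u $ i *\<^sub>R axis i 1) w = (\<Sum>i\<in>I. scl B (of_real (u $ i)) (E c z (axis i 1) w))"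
      if "finite I" for I
      using that
    proof induction
      case empty
      then show ?case using antiherm_one_form_scaleR[OF E c z w, of 0] by simp
    next
      case (insert i I)
      then show ?case
        using antiherm_one_form_add[OF E c z w] antiherm_one_form_scaleR[OF E c z w] by simp
    qed
    from this[of UNIV] show ?thesis by (simp add: basis_expansion flip: scalar_mult_eq_scaleR)
  qed
  have "antiherm_tensor_rep A B (fst c) E CARD('n) (\<lambda>a. d0 (chart_coord c (h a)))
      (\<lambda>a z. E c z (axis (h a) 1))"
    unfolding antiherm_tensor_rep_def
  proof (intro conjI allI impI ballI)
    show "open (fst c)" using open_chart[OF c] .
    show "real_one_form A (fst c) (d0 (chart_coord c (h a)))" for a
      using real_one_form_d0_chart_coord[OF c] by simp
    show "antiherm_section A B (fst c) (\<lambda>z. E c z (axis (h a) 1))" for a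
      using antiherm_one_form_section[OF E c] .
    fix c' z u w assume c': "c' \<in> A" and z: "z \<in> fst c \<inter> fst c'" and w: "w \<in> fibre B z"
    have "E c' z u w = E c z (jac c' c z u) w"
      by (rule antiherm_one_form_chart[OF E c' c IntD2[OF z] IntD1[OF z] w])
    also have "\<dots> = (\<Sum>i\<in>UNIV. scl B (of_real (jac c' c z u $ i)) (E c z (axis i 1) w))"
      by (rule exp[OF IntD1[OF z] w])
    also have "\<dots> = (\<Sum>a<CARD('n). scl B (d0 (chart_coord c (h a)) c' z u) (E c z (axis (h a) 1) w))"
      using z c c' by (subst sum.reindex_bij_betw[OF h, symmetric]) (simp add: d0_chart_coord)
    finally show "E c' z u w =
        (\<Sum>a<CARD('n). scl B (d0 (chart_coord c (h a)) c' z u) (E c z (axis (h a) 1) w))" .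
  qed
  then show ?thesis by (rule that)
qed

lemma antiherm_tensor_repD:
  assumes "antiherm_tensor_rep A B W E m \<eta> e"
  shows "open W" "a < m \<Longrightarrow> one_form A W (\<eta> a)" "a < m \<Longrightarrow> antiherm_section A B W (e a)"
    "c \<in> A \<Longrightarrow> x \<in> W \<Longrightarrow> x \<in> fst c \<Longrightarrow> w \<in> fibre B x \<Longrightarrow>
      E c x u w = (\<Sum>a<m. scl B (\<eta> a c x u) (e a x w))"
  using assms unfolding antiherm_tensor_rep_def real_one_form_def by blast+

text \<open>Linearity of the \<open>e a x\<close> expands \<open>E c x u (E c x v w)\<close> into
  the double sum with coefficients \<eta>_a(u) \<eta>_b(v); exchanging \<open>u\<close> and
  \<open>v\<close> gives the subtracted half.\<close>

lemma antiherm_tensor_rep_wedge: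
  assumes rep: "antiherm_tensor_rep A B W E m \<eta> e" and c: "c \<in> A" and x: "x \<in> W" "x \<in> fst c"
    and w: "w \<in> fibre B x"
  shows "(\<Sum>a<m. \<Sum>b<m.
       scl B (\<eta> a c x u * \<eta> b c x v - \<eta> a c x v * \<eta> b c x u) (e a x (e b x w))) =
    form_bracket E c x u v w"
proof -
  note h = antiherm_tensor_repD(3)[OF rep]
  note exp = antiherm_tensor_repD(4)[OF rep c x]
  have e: "e b x w \<in> fibre B x" if "b < m" for b
    using antiherm_section_fibre[OF h[OF that] x(1) w] .
  have "E c x u (E c x v w) = (\<Sum>a<m. \<Sum>b<m. scl B (\<eta> a c x u * \<eta> b c x v) (e a x (e b x w)))" for u v
  proof -
    have "E c x v w \<in> fibre B x"
      unfolding exp[OF w] using e by (intro fibre_sum fibre_scl) auto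
    then have "E c x u (E c x v w) = (\<Sum>a<m. scl B (\<eta> a c x u) (e a x (E c x v w)))"
      by (rule exp)
    also have "\<dots> = (\<Sum>a<m. scl B (\<eta> a c x u) (\<Sum>b<m. scl B (\<eta> b c x v) (e a x (e b x w))))"
      unfolding exp[OF w] using e by (intro sum.cong refl arg_cong2[of _ _ _ _ "scl B"]
        antiherm_section_sum_scl[OF h x(1)]) auto
    finally show ?thesis by (simp add: V.scale_sum_right)
  qed
  then show ?thesis
    unfolding form_bracket_def by (simp add: V.scale_left_diff_distrib sum_subtractf)
qed

text \<open>The coordinate decomposition gives existence for the definite description, the preceding
  evaluation gives uniqueness.\<close>

lemma wedge_square_eq:
  assumes E: "antiherm_one_form A B UNIV E" and c: "c \<in> A" and x: "x \<in> fst c" and w: "w \<in> fibre B x"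
  shows "wedge_square A B E c x u v w = form_bracket E c x u v w"
proof -
  obtain m \<eta> e where rep: "antiherm_tensor_rep A B (fst c) E m \<eta> e"
    using antiherm_tensor_rep_exists[OF E c] .
  show ?thesis
    unfolding wedge_square_def
  proof (rule the_equality, intro exI conjI)
    show "form_bracket E c x u v w = (\<Sum>a<m. \<Sum>b<m.
        scl B (\<eta> a c x u * \<eta> b c x v - \<eta> a c x v * \<eta> b c x u) (e a x (e b x w)))"
      by (rule antiherm_tensor_rep_wedge[OF rep c x x w, symmetric])
  qed (use rep x in \<open>auto simp only: antiherm_tensor_rep_wedge[OF _ c _ x w]\<close>)
qed

section \<open>The induced connection on endomorphism-valued one-forms\<close>

context
  fixes D :: "('m, 'n, 'v) sheaf_op"
  assumes D: "connection A B D"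
begin

text \<open>The Leibniz rule is applied to E_v \<sigma>, the sum of \<eta>_a(v) e_a(\<sigma>).
  Derivatives of coefficients antisymmetrize to \<open>d1 (\<eta> a)\<close>; the other terms, after
  subtraction of E_v(\<nabla>_u \<sigma>), form the commutators.\<close>

lemma antiherm_tensor_rep_end_deriv:
  assumes rep: "antiherm_tensor_rep A B W E m \<eta> e" and c: "c \<in> A" and x: "x \<in> W" "x \<in> fst c"
    and V: "open V" "x \<in> V" and \<sigma>: "bsection A B V \<sigma>"
  shows "(\<Sum>a<m. scl B (d1 (\<eta> a) c x u v) (e a x (\<sigma> x)) -
            (scl B (\<eta> a c x u) (commutator D (e a) \<sigma> c x v) -
             scl B (\<eta> a c x v) (commutator D (e a) \<sigma> c x u))) = end_deriv D E \<sigma> c x u v"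
proof -
  note W = antiherm_tensor_repD(1)[OF rep]
    and \<eta> = antiherm_tensor_repD(2)[OF rep] and h = antiherm_tensor_repD(3)[OF rep]
    and exp = antiherm_tensor_repD(4)[OF rep c]
  \<comment> \<open>\<sigma> is a section over \<open>V\<close>, the decomposition holds over
    \<open>W\<close>, and its coefficients are functions only in the chart; the Leibniz rule needs a
    common domain.\<close>
  let ?W = "V \<inter> (W \<inter> fst c)"
  have W': "open ?W" "x \<in> ?W"
    using W V open_chart[OF c] x by auto
  have \<eta>': "smooth_fun A ?W (\<lambda>z. \<eta> a c z u)" if "a < m" for a u
    by (rule smooth_fun_mono[OF smooth_fun_one_form[OF W \<eta>[OF that] c]]) blast
  have \<sigma>': "bsection A B ?W \<sigma>"
    by (rule bsection_mono[OF \<sigma>]) blast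
  have e\<sigma>: "bsection A B ?W (\<lambda>z. e a z (\<sigma> z))" if "a < m" for a
    by (rule bsection_antiherm_section[OF h[OF that] W'(1) _ \<sigma>']) blast
  have "D (\<lambda>z. E c z v (\<sigma> z)) c x u - E c x v (D \<sigma> c x u) =
      (\<Sum>a<m. scl B (d0 (\<lambda>z. \<eta> a c z v) c x u) (e a x (\<sigma> x)) +
        scl B (\<eta> a c x v) (commutator D (e a) \<sigma> c x u))" for u v
  proof -
    have "D (\<lambda>z. \<Sum>a<m. scl B (\<eta> a c z v) (e a z (\<sigma> z))) c x u = D (\<lambda>z. E c z v (\<sigma> z)) c x u"
      by (rule connection_cong[OF D W'(1) c W'(2) x(2)])
        (auto intro!: bsection_sum bsection_scl W' \<eta>' e\<sigma> exp[symmetric] bsection_fibre[OF \<sigma>])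
    moreover have "E c x v (D \<sigma> c x u) = (\<Sum>a<m. scl B (\<eta> a c x v) (e a x (D \<sigma> c x u)))"
      by (rule exp[OF x connection_fibre[OF D W'(1) c W'(2) x(2) \<sigma>']])
    ultimately show ?thesis
      using connection_sum_leibniz[OF D W'(1) c W'(2) x(2), of "{..<m}" "\<lambda>a z. \<eta> a c z v"
          "\<lambda>a z. e a z (\<sigma> z)" u] \<eta>' e\<sigma>
      unfolding commutator_def
      by (simp only: lessThan_iff V.scale_right_diff_distrib add_diff_eq sum_subtractf)
  qed
  then show ?thesis
    unfolding end_deriv_def
    by (simp only: sum_subtractf[symmetric] d1_def)
      (simp add: V.scale_left_diff_distrib algebra_simps)
qed

lemma end_conn1_eq:
  assumes E: "antiherm_one_form A B UNIV E" and c: "c \<in> A" and x: "x \<in> fst c"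
    and V: "open V" "x \<in> V" and \<sigma>: "bsection A B V \<sigma>"
  shows "end_conn1 A B D E \<sigma> c x u v = end_deriv D E \<sigma> c x u v"
proof -
  obtain m \<eta> e where rep: "antiherm_tensor_rep A B (fst c) E m \<eta> e"
    using antiherm_tensor_rep_exists[OF E c] .
  show ?thesis
    unfolding end_conn1_def
  proof (rule the_equality, intro exI conjI)
    show "end_deriv D E \<sigma> c x u v = (\<Sum>a<m. scl B (d1 (\<eta> a) c x u v) (e a x (\<sigma> x)) -
            (scl B (\<eta> a c x u) (commutator D (e a) \<sigma> c x v) -
             scl B (\<eta> a c x v) (commutator D (e a) \<sigma> c x u)))"
      by (rule antiherm_tensor_rep_end_deriv[OF rep c x x V \<sigma>, symmetric])
  qed (use rep x in \<open>auto simp only: antiherm_tensor_rep_end_deriv[OF _ c _ x V \<sigma>]\<close>)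
qed

end

end


section \<open>Limits of endomorphism-valued forms\<close>

context hermitian_vector_bundle
begin

text \<open>A common setting for the antihermitian forms and for the rescaled differences whose
  limits are taken: it contains the former and is closed under \<open>form_scale\<close> and
  \<open>form_diff\<close>.\<close>

definition end_form :: "('m, 'n, 'v \<Rightarrow> 'v) form1 \<Rightarrow> bool" where
  "end_form E \<longleftrightarrow> (\<forall>c\<in>A. \<forall>u.
     (\<forall>x\<in>fst c. \<forall>v\<in>fibre B x. E c x u v \<in> fibre B x \<and>
        (\<forall>w\<in>fibre B x. E c x u (v + w) = E c x u v + E c x u w) \<and>
        (\<forall>k. E c x u (scl B k v) = scl B k (E c x u v))) \<and>
     (\<forall>V \<sigma>. open V \<longrightarrow> V \<subseteq> fst c \<longrightarrow> bsection A B V \<sigma> \<longrightarrow> bsection A B V (\<lambda>x. E c x u (\<sigma> x))))"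

lemma
  assumes E: "end_form E" and c: "c \<in> A"
  shows end_form_fibre: "x \<in> fst c \<Longrightarrow> v \<in> fibre B x \<Longrightarrow> E c x u v \<in> fibre B x"
    and end_form_add: "x \<in> fst c \<Longrightarrow> v \<in> fibre B x \<Longrightarrow> w \<in> fibre B x \<Longrightarrow>
      E c x u (v + w) = E c x u v + E c x u w"
    and end_form_scl: "x \<in> fst c \<Longrightarrow> v \<in> fibre B x \<Longrightarrow> E c x u (scl B k v) = scl B k (E c x u v)"
    and end_form_bsection: "open V \<Longrightarrow> V \<subseteq> fst c \<Longrightarrow> bsection A B V \<sigma> \<Longrightarrow>
      bsection A B V (\<lambda>x. E c x u (\<sigma> x))"
  using E[unfolded end_form_def] c by blast+

lemma end_form_antiherm_one_form:
  assumes "antiherm_one_form A B UNIV E"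
  shows "end_form E"
  unfolding end_form_def
proof (intro ballI allI conjI impI)
  fix c u assume c: "c \<in> A"
  note h = antiherm_one_form_section[OF assms c]
  show "bsection A B V (\<lambda>x. E c x u (\<sigma> x))" if "open V" "V \<subseteq> fst c" "bsection A B V \<sigma>" for V \<sigma>
    using bsection_antiherm_section[OF h that] .
  fix x v assume x: "x \<in> fst c" "v \<in> fibre B x"
  show "E c x u v \<in> fibre B x"
    by (rule antiherm_section_fibre[OF h x])
  show "E c x u (v + w) = E c x u v + E c x u w" if "w \<in> fibre B x" for w
    by (rule antiherm_section_add[OF h x that])
  show "E c x u (scl B k v) = scl B k (E c x u v)" for k
    by (rule antiherm_section_scl[OF h x])
qed

lemma end_form_form_scale:
  assumes E: "end_form E"
  shows "end_form (form_scale B k E)"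
  unfolding end_form_def form_scale_def
  by (auto simp: end_form_add[OF E] end_form_scl[OF E] V.scale_right_distrib mult.commute
      intro: fibre_scl end_form_fibre[OF E] bsection_scl_const end_form_bsection[OF E])

lemma end_form_form_diff:
  assumes E: "end_form E" and E': "end_form E'"
  shows "end_form (form_diff E E')"
  unfolding end_form_def form_diff_def
  by (auto simp: end_form_add[OF E] end_form_scl[OF E] end_form_add[OF E'] end_form_scl[OF E']
      V.scale_right_diff_distrib
      intro: fibre_diff end_form_fibre[OF E] bsection_diff end_form_bsection[OF E]
      end_form_fibre[OF E'] end_form_bsection[OF E'])

lemma end_form_sum_scl:
  assumes E: "end_form E" and c: "c \<in> A" and x: "x \<in> fst c"
    and "\<And>i. i \<in> I \<Longrightarrow> f i \<in> fibre B x"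
  shows "E c x u (\<Sum>i\<in>I. scl B (k i) (f i)) = (\<Sum>i\<in>I. scl B (k i) (E c x u (f i)))"
proof -
  have 0: "E c x u 0 = 0"
    using end_form_scl[OF E c x fibre_zero, of _ 0] by simp
  show ?thesis
    using assms(4)
  proof (induction I rule: infinite_finite_induct)
    case (insert i I)
    then have "E c x u (scl B (k i) (f i) + (\<Sum>i\<in>I. scl B (k i) (f i))) =
        E c x u (scl B (k i) (f i)) + E c x u (\<Sum>i\<in>I. scl B (k i) (f i))"
      by (intro end_form_add[OF E c x]) (auto intro: fibre_sum fibre_scl)
    with insert show ?case
      by (simp add: end_form_scl[OF E c x])
  qed (auto simp: 0)
qed

lemma form_bracket_fibre:
  assumes "end_form E" "c \<in> A" "x \<in> fst c" "w \<in> fibre B x"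
  shows "form_bracket E c x u v w \<in> fibre B x"
  unfolding form_bracket_def by (intro fibre_diff end_form_fibre[OF assms(1-3)] assms(4))

lemma form_bracket_sum_scl:
  assumes E: "end_form E" and c: "c \<in> A" and x: "x \<in> fst c"
    and f: "\<And>i. i \<in> I \<Longrightarrow> f i \<in> fibre B x"
  shows "form_bracket E c x u v (\<Sum>i\<in>I. scl B (k i) (f i)) =
    (\<Sum>i\<in>I. scl B (k i) (form_bracket E c x u v (f i)))"
  unfolding form_bracket_def
  by (simp add: end_form_sum_scl[OF E c x] f end_form_fibre[OF E c x] V.scale_right_diff_distrib
      sum_subtractf)

text \<open>Each of the two factors contributes one \<open>k\<close>. With k = 1/t, the bracket of
  E(t)/t is that of E(t) divided by \<open>t\<^sup>2\<close>.\<close>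

lemma form_bracket_form_scale:
  assumes E: "end_form E" and c: "c \<in> A" and x: "x \<in> fst c" and w: "w \<in> fibre B x"
  shows "form_bracket (form_scale B k E) c x u v w = scl B (of_real (k\<^sup>2)) (form_bracket E c x u v w)"
  unfolding form_bracket_def form_scale_def
  by (simp add: end_form_scl[OF E c x] end_form_fibre[OF E c x] w V.scale_right_diff_distrib
      power2_eq_square)

text \<open>Inserting the orthogonal expansion between the two endomorphisms writes a matrix
  coefficient of their composition through products of matrix coefficients of the factors.\<close>

lemma herm_form_bracket:
  assumes E: "end_form E" and c: "c \<in> A" and x: "x \<in> fst c" and p: "p \<in> fibre B x" and q: "q \<in> fibre B x"
    and T: "T \<subseteq> fibre B x"
      "\<And>w. w \<in> fibre B x \<Longrightarrow> w = (\<Sum>d\<in>T. scl B (herm B x w d / herm B x d d) d)"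
  shows "herm B x (form_bracket E c x u v p) q =
    (\<Sum>d\<in>T. herm B x (E c x v p) d / herm B x d d * herm B x (E c x u d) q) -
    (\<Sum>d\<in>T. herm B x (E c x u p) d / herm B x d d * herm B x (E c x v d) q)"
proof -
  have "herm B x (E c x u (E c x v p)) q =
      (\<Sum>d\<in>T. herm B x (E c x v p) d / herm B x d d * herm B x (E c x u d) q)" for u v
  proof -
    have "E c x u (E c x v p) =
        E c x u (\<Sum>d\<in>T. scl B (herm B x (E c x v p) d / herm B x d d) d)"
      by (rule arg_cong[OF T(2)[OF end_form_fibre[OF E c x p]]])
    also have "\<dots> = (\<Sum>d\<in>T. scl B (herm B x (E c x v p) d / herm B x d d) (E c x u d))"
      using T(1) by (intro end_form_sum_scl[OF E c x]) auto
    finally show ?thesis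
      using T(1) q by (auto simp: herm_sum_scl_left end_form_fibre[OF E c x] subset_iff)
  qed
  then show ?thesis
    unfolding form_bracket_def
    by (subst herm_diff_left) (auto intro!: end_form_fibre[OF E c x] p q)
qed

section \<open>Pointwise limits from smooth convergence\<close>

context
  fixes c x U e F G L
  assumes c: "c \<in> A" and fr: "(U, e) \<in> frames B" and x: "x \<in> fst c" "x \<in> U"
    and lim: "smooth_limit A B G L F"
    and G: "\<forall>\<^sub>F t in F. end_form (G t)" and L: "end_form L"
begin

lemma smooth_limit_ideriv:
  assumes "a < brank B" "b < brank B"
  shows "((\<lambda>t. ideriv vs (mcoeff B (G t) c e u a b) (snd c x)) \<longlongrightarrow>
    ideriv vs (mcoeff B L c e u a b) (snd c x)) F"
proof -
  have "\<forall>(U, e)\<in>frames B. \<forall>u. \<forall>a<brank B. \<forall>b<brank B. \<forall>K vs.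
        compact K \<longrightarrow> K \<subseteq> snd c ` (fst c \<inter> U) \<longrightarrow>
        uniform_limit K (\<lambda>t. ideriv vs (mcoeff B (G t) c e u a b)) (ideriv vs (mcoeff B L c e u a b)) F"
    using lim c unfolding smooth_limit_def by (rule bspec)
  \<comment> \<open>A singleton is compact, and a uniform limit on it is a pointwise limit.\<close>
  from bspec[OF this fr, unfolded prod.case, rule_format, OF assms, of "{snd c x}" vs u] x
  show ?thesis
    by simp
qed

text \<open>Sesquilinear expansion of \<open>p\<close> and \<open>q\<close> in the frame, with
  coefficients independent of \<open>t\<close>. General fibre vectors occur because covariant
  derivatives of frame sections will be paired with the forms.\<close>

lemma smooth_limit_herm:
  assumes p: "p \<in> fibre B x" and q: "q \<in> fibre B x"
  shows "((\<lambda>t. herm B x (G t c x u p) q) \<longlongrightarrow> herm B x (L c x u p) q) F"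
proof -
  obtain k where k: "p = (\<Sum>a<brank B. scl B (k a) (e a x))" by (rule frame_expansion[OF fr x(2) p])
  obtain l where l: "q = (\<Sum>a<brank B. scl B (l a) (e a x))" by (rule frame_expansion[OF fr x(2) q])
  have e: "e a x \<in> fibre B x" if "a < brank B" for a
    using frame_fibre[OF fr that x(2)] .
  have *: "herm B x (E c x u p) q = (\<Sum>a<brank B. k a * (\<Sum>b<brank B. cnj (l b) *
      ideriv [] (mcoeff B E c e u a b) (snd c x)))" if E: "end_form E" for E
  proof -
    have "E c x u p = (\<Sum>a<brank B. scl B (k a) (E c x u (e a x)))"
      unfolding k using e by (intro end_form_sum_scl[OF E c x(1)]) auto
    also have "herm B x \<dots> q = (\<Sum>a<brank B. k a * herm B x (E c x u (e a x)) q)"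
      by (rule herm_sum_scl_left) (auto intro: end_form_fibre[OF E c x(1)] e q)
    also have "\<dots> = (\<Sum>a<brank B. k a * (\<Sum>b<brank B. cnj (l b) * herm B x (E c x u (e a x)) (e b x)))"
      unfolding l by (intro sum.cong refl arg_cong2[of _ _ _ _ "(*)"] herm_sum_scl_right)
        (auto intro: end_form_fibre[OF E c x(1)] e)
    finally show ?thesis
      by (simp add: mcoeff_def in_chart_apply c x)
  qed
  have "((\<lambda>t. \<Sum>a<brank B. k a * (\<Sum>b<brank B. cnj (l b) * ideriv [] (mcoeff B (G t) c e u a b) (snd c x)))
      \<longlongrightarrow> herm B x (L c x u p) q) F"
    unfolding *[OF L] by (intro tendsto_sum tendsto_mult tendsto_const smooth_limit_ideriv) auto
  then show ?thesis
    by (rule Lim_transform_eventually) (use G in eventually_elim, simp only: *)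
qed

text \<open>By \<open>herm_form_bracket\<close> the pairing is a polynomial in convergent matrix
  coefficients. The orthogonal system \<open>T\<close> depends on \<open>x\<close> alone and stays
  fixed along the filter.\<close>

lemma smooth_limit_form_bracket:
  assumes p: "p \<in> fibre B x" and q: "q \<in> fibre B x"
  shows "((\<lambda>t. herm B x (form_bracket (G t) c x u v p) q) \<longlongrightarrow> herm B x (form_bracket L c x u v p) q) F"
proof -
  obtain T where T: "T \<subseteq> fibre B x"
      "\<And>w. w \<in> fibre B x \<Longrightarrow> w = (\<Sum>d\<in>T. scl B (herm B x w d / herm B x d d) d)"
    using orthogonal_expansion[of x] by metis
  have 0: "((\<lambda>t. herm B x (G t c x u p) d / herm B x d d) \<longlongrightarrow> herm B x (L c x u p) d / herm B x d d) F"
    if "d \<in> T" for d u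
    unfolding divide_inverse using T(1) that p by (intro tendsto_mult tendsto_const smooth_limit_herm) auto
  note eq = herm_form_bracket[OF _ c x(1) p q T]
  have "((\<lambda>t. (\<Sum>d\<in>T. herm B x (G t c x v p) d / herm B x d d * herm B x (G t c x u d) q) -
      (\<Sum>d\<in>T. herm B x (G t c x u p) d / herm B x d d * herm B x (G t c x v d) q)) \<longlongrightarrow>
      (\<Sum>d\<in>T. herm B x (L c x v p) d / herm B x d d * herm B x (L c x u d) q) -
      (\<Sum>d\<in>T. herm B x (L c x u p) d / herm B x d d * herm B x (L c x v d) q)) F"
    using T(1) q by (intro tendsto_diff tendsto_sum tendsto_mult 0 smooth_limit_herm) auto
  then have "((\<lambda>t. (\<Sum>d\<in>T. herm B x (G t c x v p) d / herm B x d d * herm B x (G t c x u d) q) -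
      (\<Sum>d\<in>T. herm B x (G t c x u p) d / herm B x d d * herm B x (G t c x v d) q)) \<longlongrightarrow>
      herm B x (form_bracket L c x u v p) q) F"
    by (rule back_subst) (rule eq[OF L, symmetric])
  moreover have "\<forall>\<^sub>F t in F. (\<Sum>d\<in>T. herm B x (G t c x v p) d / herm B x d d * herm B x (G t c x u d) q) -
      (\<Sum>d\<in>T. herm B x (G t c x u p) d / herm B x d d * herm B x (G t c x v d) q) =
      herm B x (form_bracket (G t) c x u v p) q"
    using G by eventually_elim (rule eq[symmetric])
  ultimately show ?thesis
    by (rule Lim_transform_eventually)
qed

end

section \<open>Tensoriality, flatness and limits for the induced connection\<close>

context
  fixes D :: "('m, 'n, 'v) sheaf_op" and V c x
  assumes D: "connection A B D" and V: "open V" "V \<subseteq> fst c" and c: "c \<in> A" and x: "x \<in> V"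
begin

lemma point_in_chart: "x \<in> fst c"
  using V x by auto

lemma end_deriv_form_scale:
  assumes E: "end_form E" and \<sigma>: "bsection A B V \<sigma>"
  shows "end_deriv D (form_scale B k E) \<sigma> c x u v = scl B (of_real k) (end_deriv D E \<sigma> c x u v)"
  unfolding end_deriv_def form_scale_def
  by (simp add: connection_scl[OF D V(1) c x point_in_chart end_form_bsection[OF E c V \<sigma>]]
      V.scale_right_diff_distrib)

lemma end_deriv_form_diff:
  assumes E: "end_form E" and E': "end_form E'" and \<sigma>: "bsection A B V \<sigma>"
  shows "end_deriv D (form_diff E E') \<sigma> c x u v = end_deriv D E \<sigma> c x u v - end_deriv D E' \<sigma> c x u v"
  unfolding end_deriv_def form_diff_def
  by (simp add: connection_diff[OF D V(1) c x point_in_chart end_form_bsection[OF E c V \<sigma>]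
      end_form_bsection[OF E' c V \<sigma>]])

lemma end_deriv_fibre:
  assumes E: "end_form E" and \<sigma>: "bsection A B V \<sigma>"
  shows "end_deriv D E \<sigma> c x u v \<in> fibre B x"
  unfolding end_deriv_def
  by (intro fibre_diff connection_fibre[OF D V(1) c x point_in_chart] end_form_bsection[OF E c V \<sigma>]
      end_form_fibre[OF E c point_in_chart] \<sigma>)

text \<open>Tensoriality: \<nabla>_u(E_v \<sigma>) and E_v(\<nabla>_u \<sigma>) contain the same
  terms with \<open>d0 (f i)\<close>, because E_v is linear on fibres, and these cancel in the
  commutator.\<close>

lemma end_deriv_sum_scl:
  assumes E: "end_form E" and f: "\<And>i. i \<in> I \<Longrightarrow> smooth_fun A V (f i)"
    and s: "\<And>i. i \<in> I \<Longrightarrow> bsection A B V (s i)"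
    and \<sigma>: "\<And>z. z \<in> V \<Longrightarrow> \<sigma> z = (\<Sum>i\<in>I. scl B (f i z) (s i z))"
  shows "end_deriv D E \<sigma> c x u v = (\<Sum>i\<in>I. scl B (f i x) (end_deriv D E (s i) c x u v))"
proof -
  note cx = V(1) c x point_in_chart
  have 1: "D (\<lambda>z. E c z v (\<sigma> z)) c x u - E c x v (D \<sigma> c x u) =
      (\<Sum>i\<in>I. scl B (f i x) (D (\<lambda>z. E c z v (s i z)) c x u - E c x v (D (s i) c x u)))" for u v
  proof -
    have Es: "bsection A B V (\<lambda>z. E c z v (s i z))" if "i \<in> I" for i
      using end_form_bsection[OF E c V s[OF that]] .
    have "D (\<lambda>z. \<Sum>i\<in>I. scl B (f i z) (E c z v (s i z))) c x u = D (\<lambda>z. E c z v (\<sigma> z)) c x u"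
    proof (rule connection_cong[OF D cx])
      show "bsection A B V (\<lambda>z. \<Sum>i\<in>I. scl B (f i z) (E c z v (s i z)))"
        by (intro bsection_sum bsection_scl V f Es)
      show "(\<Sum>i\<in>I. scl B (f i z) (E c z v (s i z))) = E c z v (\<sigma> z)" if z: "z \<in> V" for z
        unfolding \<sigma>[OF z] using z V s
        by (intro end_form_sum_scl[OF E c, symmetric]) (auto intro: bsection_fibre)
    qed
    moreover have "D (\<lambda>z. \<Sum>i\<in>I. scl B (f i z) (s i z)) c x u = D \<sigma> c x u"
    proof (rule connection_cong[OF D cx])
      show "bsection A B V (\<lambda>z. \<Sum>i\<in>I. scl B (f i z) (s i z))"
        by (intro bsection_sum bsection_scl V f s)
    qed (simp add: \<sigma>)
    moreover have "E c x v (\<Sum>i\<in>I. scl B (d0 (f i) c x u) (s i x) + scl B (f i x) (D (s i) c x u)) =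
      (\<Sum>i\<in>I. scl B (d0 (f i) c x u) (E c x v (s i x)) + scl B (f i x) (E c x v (D (s i) c x u)))"
    proof -
      have "s i x \<in> fibre B x" "D (s i) c x u \<in> fibre B x" if "i \<in> I" for i
        using bsection_fibre[OF s[OF that] x] connection_fibre[OF D cx s[OF that]] .
      then show ?thesis
        unfolding sum.distrib
        by (subst end_form_add[OF E c point_in_chart])
          (auto intro!: fibre_sum fibre_scl simp: end_form_sum_scl[OF E c point_in_chart])
    qed
    ultimately have
      "D (\<lambda>z. E c z v (\<sigma> z)) c x u =
        (\<Sum>i\<in>I. scl B (d0 (f i) c x u) (E c x v (s i x)) + scl B (f i x) (D (\<lambda>z. E c z v (s i z)) c x u))"
      "E c x v (D \<sigma> c x u) =
        (\<Sum>i\<in>I. scl B (d0 (f i) c x u) (E c x v (s i x)) + scl B (f i x) (E c x v (D (s i) c x u)))"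
      using connection_sum_leibniz[OF D cx f Es, of I "\<lambda>i. i" "\<lambda>i. i" u]
        connection_sum_leibniz[OF D cx f s, of I "\<lambda>i. i" "\<lambda>i. i" u] by simp_all
    then show ?thesis
      by (simp only: sum_subtractf[symmetric]) (simp add: V.scale_right_diff_distrib)
  qed
  show ?thesis
    unfolding end_deriv_def 1 by (simp add: V.scale_right_diff_distrib sum_subtractf)
qed

text \<open>Expanding the curvature of \<nabla> + E gives the curvature of \<nabla>, the mixed
  terms, which form \<open>end_deriv\<close>, and the terms quadratic in \<open>E\<close>, which
  form the bracket. As both curvatures vanish, the Maurer-Cartan equation remains.\<close>

lemma flat_end_deriv:
  assumes flat: "flat A B D" and E: "end_form E"
    and D': "connection A B (add_form D E)" and flat': "flat A B (add_form D E)"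
    and \<sigma>: "bsection A B V \<sigma>"
  shows "end_deriv D E \<sigma> c x u v + form_bracket E c x u v (\<sigma> x) = 0"
proof -
  note cx = V(1) c x point_in_chart
  \<comment> \<open>Stated for an arbitrary flat connection, to be used for \<open>D\<close> and for
    \<open>add_form D E\<close>.\<close>
  have 0: "D (\<lambda>z. D \<sigma> c z v) c x u - D (\<lambda>z. D \<sigma> c z u) c x v = 0"
    if D: "connection A B D" and flat: "flat A B D" for D :: "('m, 'n, 'v) sheaf_op"
  proof -
    have "conn1 A B D (D \<sigma>) c x u v = 0"
      using flat \<sigma> V c x point_in_chart unfolding flat_def by blast
    then show ?thesis
      using conn1_eq[OF D V(1) conjunct1[OF connection_axioms[OF D V(1) \<sigma>]] c x point_in_chart] by simp
  qed
  have s: "bsection A B V (\<lambda>z. D \<sigma> c z v)" for v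
    using bsection_connection[OF D cx \<sigma>] V by (simp add: Int_absorb2)
  have E\<sigma>: "bsection A B V (\<lambda>z. E c z v (\<sigma> z))" for v
    using end_form_bsection[OF E c V \<sigma>] .
  have "add_form D E (\<lambda>z. add_form D E \<sigma> c z v) c x u =
      D (\<lambda>z. D \<sigma> c z v) c x u + D (\<lambda>z. E c z v (\<sigma> z)) c x u +
      (E c x u (D \<sigma> c x v) + E c x u (E c x v (\<sigma> x)))" for u v
    unfolding add_form_def
    by (simp add: connection_add[OF D cx s E\<sigma>] end_form_add[OF E c point_in_chart]
        bsection_fibre[OF s x] bsection_fibre[OF E\<sigma> x])
  with 0[OF D flat] 0[OF D' flat'] show ?thesis
    unfolding end_deriv_def form_bracket_def by (simp add: algebra_simps)
qed

text \<open>Metric compatibility moves \<nabla>_u to the other argument at the cost of an ordinary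
  derivative of a matrix coefficient. Only first derivatives of \<open>mcoeff\<close> and pairings
  of \<open>E\<close> with fixed fibre vectors remain, all controlled by smooth convergence.\<close>

lemma herm_end_deriv:
  assumes herm: "hermitian_connection A B D" and E: "end_form E"
    and fr: "(U, e) \<in> frames B" "V \<subseteq> U" and ab: "a < brank B" "b < brank B"
  shows "herm B x (end_deriv D E (e a) c x u v) (e b x) =
    (ideriv [u] (mcoeff B E c e v a b) (snd c x) - herm B x (E c x v (e a x)) (D (e b) c x u) -
      herm B x (E c x v (D (e a) c x u)) (e b x)) -
    (ideriv [v] (mcoeff B E c e u a b) (snd c x) - herm B x (E c x u (e a x)) (D (e b) c x v) -
      herm B x (E c x u (D (e a) c x v)) (e b x))"
proof -
  note cx = V(1) c x point_in_chart
  have e: "bsection A B V (e a)" if "a < brank B" for a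
    using bsection_mono[OF bsection_frame[OF fr(1) that] fr(2)] .
  have f: "e b x \<in> fibre B x" "D (e a) c x u \<in> fibre B x" "D (\<lambda>z. E c z v (e a z)) c x u \<in> fibre B x" for u v
    using bsection_fibre[OF e[OF ab(2)] x] connection_fibre[OF D cx e[OF ab(1)]]
      connection_fibre[OF D cx end_form_bsection[OF E c V e[OF ab(1)]]] .
  have "herm B x (D (\<lambda>z. E c z v (e a z)) c x u) (e b x) =
      ideriv [u] (mcoeff B E c e v a b) (snd c x) - herm B x (E c x v (e a x)) (D (e b) c x u)" for u v
  proof -
    have "herm B x (D (\<lambda>z. E c z v (e a z)) c x u) (e b x) + herm B x (E c x v (e a x)) (D (e b) c x u) =
        d0 (\<lambda>z. herm B z (E c z v (e a z)) (e b z)) c x u"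
      using conjunct2[OF herm[unfolded hermitian_connection_def]] V(1)
        end_form_bsection[OF E c V e[OF ab(1)], of v] e[OF ab(2)] c x point_in_chart by blast
    then show ?thesis
      by (simp add: d0_def mcoeff_def algebra_simps)
  qed
  then show ?thesis
    unfolding end_deriv_def
    by (simp add: herm_diff_left f fibre_diff end_form_fibre[OF E c point_in_chart])
qed

text \<open>The terms of \<open>herm_end_deriv\<close> converge one by one; the two derivatives of
  coefficients are where convergence beyond order zero enters.\<close>

lemma smooth_limit_end_deriv:
  assumes herm: "hermitian_connection A B D" and lim: "smooth_limit A B G L F"
    and G: "\<forall>\<^sub>F t in F. end_form (G t)" and L: "end_form L"
    and fr: "(U, e) \<in> frames B" "V \<subseteq> U" and ab: "a < brank B" "b < brank B"
  shows "((\<lambda>t. herm B x (end_deriv D (G t) (e a) c x u v) (e b x)) \<longlongrightarrow>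
    herm B x (end_deriv D L (e a) c x u v) (e b x)) F"
proof -
  have xU: "x \<in> U" using x fr by auto
  have e: "bsection A B V (e a)" if "a < brank B" for a
    using bsection_mono[OF bsection_frame[OF fr(1) that] fr(2)] .
  have f: "e a x \<in> fibre B x" "D (e a) c x u \<in> fibre B x" if "a < brank B" for a u
    using bsection_fibre[OF e[OF that] x] connection_fibre[OF D V(1) c x point_in_chart e[OF that]] .
  note lims = smooth_limit_ideriv[OF c fr(1) point_in_chart xU lim G L ab]
    smooth_limit_herm[OF c fr(1) point_in_chart xU lim G L]
  note eq = herm_end_deriv[OF herm _ fr ab]
  have "((\<lambda>t. (ideriv [u] (mcoeff B (G t) c e v a b) (snd c x) - herm B x (G t c x v (e a x)) (D (e b) c x u) -
      herm B x (G t c x v (D (e a) c x u)) (e b x)) -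
    (ideriv [v] (mcoeff B (G t) c e u a b) (snd c x) - herm B x (G t c x u (e a x)) (D (e b) c x v) -
      herm B x (G t c x u (D (e a) c x v)) (e b x))) \<longlongrightarrow>
    herm B x (end_deriv D L (e a) c x u v) (e b x)) F"
    unfolding eq[OF L] by (intro tendsto_diff lims f ab)
  then show ?thesis
    by (rule Lim_transform_eventually) (use G in eventually_elim, simp only: eq)
qed

end

end

section \<open>First and second order terms of the flatness equation\<close>

theorem proposition7:
  fixes A :: "('m::{t2_space, second_countable_topology}, 'n::finite) chart set"
    and g :: "('m, 'n) chart \<Rightarrow> 'm \<Rightarrow> real ^ 'n \<Rightarrow> real ^ 'n \<Rightarrow> real"
    and F :: "('m, 'v::ab_group_add) vbundle"
    and D :: "('m, 'n, 'v) sheaf_op"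
    and E :: "real \<Rightarrow> ('m, 'n, 'v \<Rightarrow> 'v) form1"
    and E\<^sub>1 E\<^sub>2 :: "('m, 'n, 'v \<Rightarrow> 'v) form1"
  assumes "oriented_riemannian_manifold A g"
    and "compact (UNIV :: 'm set)"
    and "connected (UNIV :: 'm set)"
    and "hermitian_bundle A F"
    and "hermitian_connection A F D"
    and "flat A F D"
    and "\<And>t. t \<ge> 0 \<Longrightarrow> antiherm_one_form A F UNIV (E t)"
    and "\<And>t. t \<ge> 0 \<Longrightarrow> hermitian_connection A F (add_form D (E t))"
    and "\<And>c x u v. c \<in> A \<Longrightarrow> x \<in> fst c \<Longrightarrow> v \<in> fibre F x \<Longrightarrow> E 0 c x u v = 0"
    and "antiherm_one_form A F UNIV E\<^sub>1"
    and "antiherm_one_form A F UNIV E\<^sub>2"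
    and "smooth_limit A F (\<lambda>t. form_scale F (1 / t) (E t)) E\<^sub>1 (at_right 0)"
    and "smooth_limit A F (\<lambda>t. form_scale F (1 / t\<^sup>2) (form_diff (E t) (form_scale F t E\<^sub>1))) E\<^sub>2 (at_right 0)"
    and "smooth_bigo A F
           (\<lambda>t. form_diff (form_diff (E t) (form_scale F t E\<^sub>1)) (form_scale F (t\<^sup>2) E\<^sub>2))
           (\<lambda>t. t ^ 3) (at_right 0)"
    and "\<And>t. t \<ge> 0 \<Longrightarrow> flat A F (add_form D (E t))"
  shows "zero_on_sections A F (C_E A F D E\<^sub>1 E\<^sub>2)"
proof -
  have connD: "connection A F D"
    using assms(5) by (simp add: hermitian_connection_def)
  interpret hermitian_vector_bundle A F
    using assms(1,4) by unfold_locales (auto simp: oriented_riemannian_manifold_def)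
  let ?G\<^sub>1 = "\<lambda>t. form_scale F (1 / t) (E t)"
  let ?G\<^sub>2 = "\<lambda>t. form_scale F (1 / t\<^sup>2) (form_diff (E t) (form_scale F t E\<^sub>1))"
  have E: "end_form (E t)" if "t > 0" for t
    using end_form_antiherm_one_form[OF assms(7)] that by simp
  have E\<^sub>1: "end_form E\<^sub>1" and E\<^sub>2: "end_form E\<^sub>2"
    using end_form_antiherm_one_form assms(10,11) by blast+
  have G\<^sub>1: "end_form (?G\<^sub>1 t)" and G\<^sub>2: "end_form (?G\<^sub>2 t)" if "t > 0" for t
    using E[OF that] E\<^sub>1 by (auto intro: end_form_form_scale end_form_form_diff)
  have pos: "\<forall>\<^sub>F t in at_right 0. t > (0 :: real)"
    by (rule eventually_at_right_less)
  \<comment> \<open>Frame sections come first, since \<open>smooth_limit\<close> controls matrix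
    coefficients with respect to frames.\<close>
  have C_E_frame: "end_deriv D E\<^sub>2 (e a) c x u v + form_bracket E\<^sub>1 c x u v (e a x) = 0"
    if c: "c \<in> A" and fr: "(U, e) \<in> frames F" and x: "x \<in> fst c" "x \<in> U" and a: "a < brank F"
    for c U e x a u v
  proof -
    let ?V = "fst c \<inter> U"
    have V: "open ?V" "?V \<subseteq> fst c" "x \<in> ?V" "?V \<subseteq> U"
      using open_chart[OF c] frame_open[OF fr] x by auto
    note ctx = connD V(1,2) c V(3)
    have ea: "bsection A F ?V (e a)" "e a x \<in> fibre F x"
      using bsection_mono[OF bsection_frame[OF fr a] V(4)] frame_fibre[OF fr a x(2)] .
    \<comment> \<open>The Maurer-Cartan equation for E(t), solved for the derivative term;
      \<open>t\<close> is positive since divisions by \<open>t\<close> follow.\<close>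
    have flat: "end_deriv D (E t) (e a) c x u v = - form_bracket (E t) c x u v (e a x)" if t: "t > 0" for t
      using flat_end_deriv[OF ctx assms(6) E[OF t] _ assms(15) ea(1)] assms(8)[of t] t
      by (simp add: hermitian_connection_def eq_neg_iff_add_eq_0)
    have bracket_scale: "form_bracket (?G\<^sub>1 t) c x u v (e a x) = scl F (of_real (1 / t\<^sup>2)) (form_bracket (E t) c x u v (e a x))"
      if t: "t > 0" for t
      using form_bracket_form_scale[OF E[OF t] c x(1) ea(2), of "1 / t"] by (simp add: power_one_over)
    have bracket_lim: "((\<lambda>t. herm F x (form_bracket (?G\<^sub>1 t) c x u v (e a x)) (e b x)) \<longlongrightarrow>
        herm F x (form_bracket E\<^sub>1 c x u v (e a x)) (e b x)) (at_right 0)" if b: "b < brank F" for b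
      by (rule smooth_limit_form_bracket[OF c fr x assms(12) _ E\<^sub>1 ea(2) frame_fibre[OF fr b x(2)]])
        (use pos G\<^sub>1 in \<open>auto elim: eventually_mono\<close>)
    have fb: "e b x \<in> fibre F x" if "b < brank F" for b
      using frame_fibre[OF fr that x(2)] .
    have bracket: "form_bracket E' c x u v (e a x) \<in> fibre F x" if "end_form E'" for E'
      by (rule form_bracket_fibre[OF that c x(1) ea(2)])
    \<comment> \<open>The term of first order must vanish before the equation can be divided by
      \<open>t\<^sup>2\<close>.\<close>
    have first: "end_deriv D E\<^sub>1 (e a) c x u v = 0"
    proof (rule herm_nondegenerate[OF fr x(2) end_deriv_fibre[OF ctx E\<^sub>1 ea(1)]])
      fix b assume b: "b < brank F"
      have "((\<lambda>t. herm F x (end_deriv D (?G\<^sub>1 t) (e a) c x u v) (e b x)) \<longlongrightarrow>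
          herm F x (end_deriv D E\<^sub>1 (e a) c x u v) (e b x)) (at_right 0)"
        by (rule smooth_limit_end_deriv[OF ctx assms(5,12) _ E\<^sub>1 fr V(4) a b])
          (use pos G\<^sub>1 in \<open>auto elim: eventually_mono\<close>)
      \<comment> \<open>The derivative term of E(t)/t equals -t times the bracket of E(t)/t, a null
        factor times a convergent one. The limit is left as \<open>of_real (- 0)\<close>, the
        literal form that the limit rules deliver.\<close>
      moreover have "((\<lambda>t. herm F x (end_deriv D (?G\<^sub>1 t) (e a) c x u v) (e b x)) \<longlongrightarrow>
          of_real (- 0) * herm F x (form_bracket E\<^sub>1 c x u v (e a x)) (e b x)) (at_right 0)"
      proof (rule Lim_transform_eventually)
        show "((\<lambda>t. of_real (- t) * herm F x (form_bracket (?G\<^sub>1 t) c x u v (e a x)) (e b x)) \<longlongrightarrow>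
            of_real (- 0) * herm F x (form_bracket E\<^sub>1 c x u v (e a x)) (e b x)) (at_right 0)"
          by (intro tendsto_mult bracket_lim b tendsto_of_real tendsto_minus tendsto_ident_at)
        show "\<forall>\<^sub>F t in at_right 0. of_real (- t) * herm F x (form_bracket (?G\<^sub>1 t) c x u v (e a x)) (e b x) =
            herm F x (end_deriv D (?G\<^sub>1 t) (e a) c x u v) (e b x)"
          using pos
        proof eventually_elim
          case (elim t)
          have "end_deriv D (?G\<^sub>1 t) (e a) c x u v = scl F (of_real (- t)) (form_bracket (?G\<^sub>1 t) c x u v (e a x))"
            using elim by (simp add: end_deriv_form_scale[OF ctx E ea(1)] flat bracket_scale
                power2_eq_square)
          then show ?case
            by (simp only: herm_scl_left[OF bracket[OF G\<^sub>1[OF elim]] fb[OF b]])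
        qed
      qed
      ultimately show "herm F x (end_deriv D E\<^sub>1 (e a) c x u v) (e b x) = 0"
        using tendsto_unique[OF trivial_limit_at_right_real] by fastforce
    qed
    show ?thesis
    proof (rule herm_nondegenerate[OF fr x(2)])
      show "end_deriv D E\<^sub>2 (e a) c x u v + form_bracket E\<^sub>1 c x u v (e a x) \<in> fibre F x"
        by (rule fibre_add[OF end_deriv_fibre[OF ctx E\<^sub>2 ea(1)] bracket[OF E\<^sub>1]])
      fix b assume b: "b < brank F"
      have "((\<lambda>t. herm F x (end_deriv D (?G\<^sub>2 t) (e a) c x u v) (e b x)) \<longlongrightarrow>
          herm F x (end_deriv D E\<^sub>2 (e a) c x u v) (e b x)) (at_right 0)"
        by (rule smooth_limit_end_deriv[OF ctx assms(5,13) _ E\<^sub>2 fr V(4) a b])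
          (use pos G\<^sub>2 in \<open>auto elim: eventually_mono\<close>)
      \<comment> \<open>In the derivative of E(t) - t E_1 the contribution of E_1 is zero by
        \<open>first\<close>. Division by \<open>t\<^sup>2\<close> then turns the bracket of E(t)
        into that of E(t)/t, whose limit is known.\<close>
      moreover have "((\<lambda>t. herm F x (end_deriv D (?G\<^sub>2 t) (e a) c x u v) (e b x)) \<longlongrightarrow>
          - herm F x (form_bracket E\<^sub>1 c x u v (e a x)) (e b x)) (at_right 0)"
      proof (rule Lim_transform_eventually)
        show "((\<lambda>t. - herm F x (form_bracket (?G\<^sub>1 t) c x u v (e a x)) (e b x)) \<longlongrightarrow>
            - herm F x (form_bracket E\<^sub>1 c x u v (e a x)) (e b x)) (at_right 0)"
          by (intro tendsto_minus bracket_lim b)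
        show "\<forall>\<^sub>F t in at_right 0. - herm F x (form_bracket (?G\<^sub>1 t) c x u v (e a x)) (e b x) =
            herm F x (end_deriv D (?G\<^sub>2 t) (e a) c x u v) (e b x)"
          using pos
        proof eventually_elim
          case (elim t)
          \<comment> \<open>The sign is written as the scalar \<open>- 1\<close> so that
            \<open>herm_scl_left\<close> can move it out of the pairing.\<close>
          have "end_deriv D (?G\<^sub>2 t) (e a) c x u v = scl F (- 1) (form_bracket (?G\<^sub>1 t) c x u v (e a x))"
            using elim E\<^sub>1 by (simp add: end_deriv_form_scale[OF ctx _ ea(1)] end_deriv_form_diff[OF ctx _ _ ea(1)]
                end_form_form_scale end_form_form_diff E flat first bracket_scale)
          then show ?case
            by (simp only: herm_scl_left[OF bracket[OF G\<^sub>1[OF elim]] fb[OF b]]) simp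
        qed
      qed
      ultimately have "herm F x (end_deriv D E\<^sub>2 (e a) c x u v) (e b x) =
          - herm F x (form_bracket E\<^sub>1 c x u v (e a x)) (e b x)"
        by (rule tendsto_unique[OF trivial_limit_at_right_real])
      then show "herm F x (end_deriv D E\<^sub>2 (e a) c x u v + form_bracket E\<^sub>1 c x u v (e a x)) (e b x) = 0"
        by (simp add: herm_add_left[OF end_deriv_fibre[OF ctx E\<^sub>2 ea(1)] bracket[OF E\<^sub>1] fb[OF b]])
    qed
  qed
  show ?thesis
    unfolding zero_on_sections_def
  proof (intro allI impI ballI)
    fix W \<sigma> c x u v
    assume W: "open W" and \<sigma>: "bsection A F W \<sigma>" and c: "c \<in> A" and x: "x \<in> W \<inter> fst c"
    \<comment> \<open>Near \<open>x\<close> any section is a combination of frame sections with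
      smooth coefficients, and both summands of \<open>C_E\<close> are tensorial, so the frame case
      suffices.\<close>
    obtain U e where fr: "(U, e) \<in> frames F" "x \<in> U" by (rule frame_cover)
    let ?V = "W \<inter> U \<inter> fst c"
    have V: "open ?V" "?V \<subseteq> fst c" "x \<in> ?V"
      using W open_chart[OF c] frame_open[OF fr(1)] fr(2) x by auto
    have xc: "x \<in> fst c" "x \<in> W" using x by auto
    obtain f where f: "\<And>a. a < brank F \<Longrightarrow> smooth_fun A (W \<inter> U) (f a)"
      and \<sigma>_eq: "\<And>z. z \<in> W \<inter> U \<Longrightarrow> \<sigma> z = (\<Sum>a<brank F. scl F (f a z) (e a z))"
      using bsection_coeffs[OF \<sigma> fr(1)] by metis
    have "C_E A F D E\<^sub>1 E\<^sub>2 \<sigma> c x u v = end_deriv D E\<^sub>2 \<sigma> c x u v + form_bracket E\<^sub>1 c x u v (\<sigma> x)"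
      unfolding C_E_def
      by (simp only: end_conn1_eq[OF connD assms(11) c xc(1) W xc(2) \<sigma>]
          wedge_square_eq[OF assms(10) c xc(1) bsection_fibre[OF \<sigma> xc(2)]])
    also have "end_deriv D E\<^sub>2 \<sigma> c x u v = (\<Sum>a<brank F. scl F (f a x) (end_deriv D E\<^sub>2 (e a) c x u v))"
    proof (rule end_deriv_sum_scl[OF connD V(1,2) c V(3) E\<^sub>2])
      show "smooth_fun A ?V (f a)" if "a \<in> {..<brank F}" for a
        by (rule smooth_fun_mono[OF f]) (use that in auto)
      show "bsection A F ?V (e a)" if "a \<in> {..<brank F}" for a
        by (rule bsection_mono[OF bsection_frame[OF fr(1)]]) (use that in auto)
      show "\<sigma> z = (\<Sum>a<brank F. scl F (f a z) (e a z))" if "z \<in> ?V" for z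
        by (rule \<sigma>_eq) (use that in auto)
    qed
    also have "form_bracket E\<^sub>1 c x u v (\<sigma> x) = (\<Sum>a<brank F. scl F (f a x) (form_bracket E\<^sub>1 c x u v (e a x)))"
      unfolding \<sigma>_eq[OF IntI[OF xc(2) fr(2)]]
      by (rule form_bracket_sum_scl[OF E\<^sub>1 c xc(1)]) (use frame_fibre[OF fr(1) _ fr(2)] in auto)
    finally show "C_E A F D E\<^sub>1 E\<^sub>2 \<sigma> c x u v = 0"
      by (simp add: C_E_frame[OF c fr(1) xc(1) fr(2)] flip: sum.distrib V.scale_right_distrib)
  qed
qed

end
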